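(* Let $\beta>1$, and let $A$ be a scalar type spectral operator in a complex Banach space $(X,\|\cdot\|)$ with spectrum $\sigma(A)$. Then $A$ generates an $\mathcal{E}^{(\beta)}$-semigroup (a Beurling type Gevrey ultradifferentiable $C_0$-semigroup of order $\beta$) if and only if for any $b>0$ there is an $a\in\mathbb{R}$ such that $$\operatorname{Re}\lambda\le a-b|\operatorname{Im}\lambda|^{1/\beta}\quad\text{for all }\lambda\in\sigma(A).$$
   Context: Scalar type spectral operator (in the sense of Dunford): a densely defined closed linear operator $A$ in a complex Banach space $X$ for which there is a spectral measure (resolution of the identity) $E_A(\cdot)$ on the Borel subsets of $\mathbb{C}$, that is, a strongly countably additive Boolean-homomorphic family of bounded projections on $X$ with $E_A(\mathbb{C})=I$ and $E_A(\delta\cap\sigma)=E_A(\delta)E_A(\sigma)$, supported on the spectrum $\sigma(A)$, such that $A=\int_{\sigma(A)}\lambda\,dE_A(\lambda)$. Here, for a Borel measurable $F:\sigma(A)\to\mathbb{C}$, the operator $F(A)=\int_{\sigma(A)}F(\lambda)\,dE_A(\lambda)$ is defined by $F(A)f:=\lim_{n\to\infty}F_n(A)f$ on the domain of all $f\in X$ for which this limit exists, where $F_n:=F\cdot\chi_{\{\lambda\in\sigma(A):|F(\lambda)|\le n\}}$ and $F_n(A)=\int_{\sigma(A)}F_n\,dE_A$ is the bounded operator given by the integral of a bounded Borel function with respect to $E_A$. $\mathcal{E}^{(\beta)}$-semigroup: a $C_0$-semigroup (strongly continuous one-parameter semigroup of bounded linear operators) $\{S(t)\,|\,t\ge0\}$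 on $X$ such that for each $f\in X$ the orbit $g=S(\cdot)f$ is strongly infinitely differentiable on $(0,\infty)$ and for every $[a,b]\subseteq(0,\infty)$ and every $\alpha>0$ there is $c>0$ with $\max_{a\le t\le b}\|g^{(n)}(t)\|\le c\,\alpha^n [n!]^\beta$ for all $n=0,1,2,\dots$. "$A$ generates an $\mathcal{E}^{(\beta)}$-semigroup" means that $A$ is the infinitesimal generator of a $C_0$-semigroup that is an $\mathcal{E}^{(\beta)}$-semigroup. *)

theory Defs
  imports "HOL-Analysis.Analysis"
begin

class complex_banach = banach +
  fixes scaleC :: "complex \<Rightarrow> 'a \<Rightarrow> 'a"  (infixr \<open>*\<^sub>C\<close> 75)
  assumes scaleC_add_right: "c *\<^sub>C (x + y) = c *\<^sub>C x + c *\<^sub>C y"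
    and scaleC_add_left: "(c + d) *\<^sub>C x = c *\<^sub>C x + d *\<^sub>C x"
    and scaleC_scaleC: "c *\<^sub>C (d *\<^sub>C x) = (c * d) *\<^sub>C x"
    and scaleC_of_real: "complex_of_real r *\<^sub>C x = r *\<^sub>R x"
    and norm_scaleC: "norm (c *\<^sub>C x) = cmod c * norm x"

instantiation complex :: complex_banach
begin

definition scaleC_complex :: "complex \<Rightarrow> complex \<Rightarrow> complex"
  where "scaleC_complex = (*)"

instance
  by standard (simp_all add: scaleC_complex_def algebra_simps norm_mult scaleR_conv_of_real)

end

definition bounded_clinear :: "('a::complex_banach \<Rightarrow> 'a) \<Rightarrow> bool"
  where "bounded_clinear T \<longleftrightarrow> bounded_linear T \<and> (\<forall>c x. T (c *\<^sub>C x) = c *\<^sub>C T x)"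

text \<open>An unbounded operator is a pair of its domain \<open>D\<close> and a total function \<open>A\<close>;
  the values of \<open>A\<close> outside \<open>D\<close> are irrelevant.\<close>

locale densely_defined_closed_operator =
  fixes D :: "'a::complex_banach set" and A :: "'a \<Rightarrow> 'a"
  assumes zero_mem: "0 \<in> D"
    and add_mem: "x \<in> D \<Longrightarrow> y \<in> D \<Longrightarrow> x + y \<in> D"
    and scaleC_mem: "x \<in> D \<Longrightarrow> c *\<^sub>C x \<in> D"
    and map_add: "x \<in> D \<Longrightarrow> y \<in> D \<Longrightarrow> A (x + y) = A x + A y"
    and map_scaleC: "x \<in> D \<Longrightarrow> A (c *\<^sub>C x) = c *\<^sub>C A x"
    and dense: "closure D = UNIV"
    and closed_graph: "closed {(x, A x) | x. x \<in> D}"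

definition resolvent_set :: "'a::complex_banach set \<Rightarrow> ('a \<Rightarrow> 'a) \<Rightarrow> complex set"
  where "resolvent_set D A =
    {z. bij_betw (\<lambda>x. A x - z *\<^sub>C x) D UNIV \<and>
        bounded_clinear (inv_into D (\<lambda>x. A x - z *\<^sub>C x))}"

definition spectrum :: "'a::complex_banach set \<Rightarrow> ('a \<Rightarrow> 'a) \<Rightarrow> complex set"
  where "spectrum D A = - resolvent_set D A"

locale spectral_measure =
  fixes E :: "complex set \<Rightarrow> 'a::complex_banach \<Rightarrow> 'a"
  assumes bounded: "\<delta> \<in> sets borel \<Longrightarrow> bounded_clinear (E \<delta>)"
    and projection: "\<delta> \<in> sets borel \<Longrightarrow> E \<delta> \<circ> E \<delta> = E \<delta>"
    and whole: "E UNIV = id"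
    and compl: "\<delta> \<in> sets borel \<Longrightarrow> E (- \<delta>) x = x - E \<delta> x"
    and inter: "\<delta> \<in> sets borel \<Longrightarrow> \<sigma> \<in> sets borel \<Longrightarrow> E (\<delta> \<inter> \<sigma>) = E \<delta> \<circ> E \<sigma>"
    and countably_additive:
      "range \<Delta> \<subseteq> sets borel \<Longrightarrow> disjoint_family \<Delta> \<Longrightarrow>
        (\<lambda>n::nat. E (\<Delta> n) x) sums E (\<Union>n. \<Delta> n) x"

definition simple_spectral_integral ::
    "(complex set \<Rightarrow> 'a::complex_banach \<Rightarrow> 'a) \<Rightarrow> (complex \<Rightarrow> complex) \<Rightarrow> 'a \<Rightarrow> 'a"
  where "simple_spectral_integral E s x = (\<Sum>c\<in>range s. c *\<^sub>C E (s -` {c}) x)"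

text \<open>The integral of a bounded Borel function is the limit of the integrals of any sequence of
  simple Borel functions converging to it uniformly. The limit does not depend on the sequence,
  because a spectral measure is automatically uniformly bounded. The definition is meaningful only
  for bounded Borel functions \<open>F\<close>.\<close>

definition bounded_spectral_integral ::
    "(complex set \<Rightarrow> 'a::complex_banach \<Rightarrow> 'a) \<Rightarrow> (complex \<Rightarrow> complex) \<Rightarrow> 'a \<Rightarrow> 'a"
  where "bounded_spectral_integral E F x =
    (THE y. \<exists>s. (\<forall>n. simple_function borel (s n)) \<and> uniform_limit UNIV s F sequentially \<and>
      (\<lambda>n. simple_spectral_integral E (s n) x) \<longlonglongrightarrow> y)"

definition truncation :: "complex set \<Rightarrow> (complex \<Rightarrow> complex) \<Rightarrow> nat \<Rightarrow> complex \<Rightarrow> complex"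
  where "truncation S F n z = F z * indicator {w \<in> S. cmod (F w) \<le> real n} z"

definition spectral_integral_domain ::
    "(complex set \<Rightarrow> 'a::complex_banach \<Rightarrow> 'a) \<Rightarrow> complex set \<Rightarrow> (complex \<Rightarrow> complex) \<Rightarrow> 'a set"
  where "spectral_integral_domain E S F =
    {x. convergent (\<lambda>n. bounded_spectral_integral E (truncation S F n) x)}"

definition spectral_integral ::
    "(complex set \<Rightarrow> 'a::complex_banach \<Rightarrow> 'a) \<Rightarrow> complex set \<Rightarrow> (complex \<Rightarrow> complex) \<Rightarrow> 'a \<Rightarrow> 'a"
  where "spectral_integral E S F x =
    lim (\<lambda>n. bounded_spectral_integral E (truncation S F n) x)"

definition scalar_type_spectral :: "'a::complex_banach set \<Rightarrow> ('a \<Rightarrow> 'a) \<Rightarrow> bool"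
  where "scalar_type_spectral D A \<longleftrightarrow>
    densely_defined_closed_operator D A \<and>
    (\<exists>E. spectral_measure E \<and> E (spectrum D A) = id \<and>
      D = spectral_integral_domain E (spectrum D A) (\<lambda>z. z) \<and>
      (\<forall>x\<in>D. A x = spectral_integral E (spectrum D A) (\<lambda>z. z) x))"

text \<open>The index set of a semigroup is \<open>[0, \<infinity>)\<close>; values at negative times are irrelevant.\<close>

locale C0_semigroup =
  fixes S :: "real \<Rightarrow> 'a::complex_banach \<Rightarrow> 'a"
  assumes bounded: "t \<ge> 0 \<Longrightarrow> bounded_clinear (S t)"
    and zero: "S 0 = id"
    and add: "s \<ge> 0 \<Longrightarrow> t \<ge> 0 \<Longrightarrow> S (s + t) = S s \<circ> S t"
    and strongly_continuous: "continuous_on {0..} (\<lambda>t. S t x)"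

definition is_generator ::
    "(real \<Rightarrow> 'a::complex_banach \<Rightarrow> 'a) \<Rightarrow> 'a set \<Rightarrow> ('a \<Rightarrow> 'a) \<Rightarrow> bool"
  where "is_generator S D A \<longleftrightarrow>
    D = {x. \<exists>y. ((\<lambda>h. (1 / h) *\<^sub>R (S h x - x)) \<longlongrightarrow> y) (at_right 0)} \<and>
    (\<forall>x\<in>D. ((\<lambda>h. (1 / h) *\<^sub>R (S h x - x)) \<longlongrightarrow> A x) (at_right 0))"

definition higher_vector_derivative ::
    "nat \<Rightarrow> (real \<Rightarrow> 'a::real_normed_vector) \<Rightarrow> real \<Rightarrow> 'a"
  where "higher_vector_derivative n g = ((\<lambda>h t. vector_derivative h (at t)) ^^ n) g"

text \<open>Strong infinite differentiability; meant for open \<open>I\<close>, where the derivatives of \<open>g\<close> on \<open>I\<close>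
  depend only on the values of \<open>g\<close> on \<open>I\<close>.\<close>

definition infinitely_differentiable_on ::
    "(real \<Rightarrow> 'a::real_normed_vector) \<Rightarrow> real set \<Rightarrow> bool"
  where "infinitely_differentiable_on g I \<longleftrightarrow>
    (\<forall>n. \<forall>t\<in>I. higher_vector_derivative n g differentiable (at t))"

definition gevrey_beurling :: "real \<Rightarrow> (real \<Rightarrow> 'a::real_normed_vector) \<Rightarrow> bool"
  where "gevrey_beurling \<beta> g \<longleftrightarrow>
    infinitely_differentiable_on g {0<..} \<and>
    (\<forall>a b. 0 < a \<and> a \<le> b \<longrightarrow> (\<forall>\<alpha>>0. \<exists>c>0. \<forall>n. \<forall>t\<in>{a..b}.
      norm (higher_vector_derivative n g t) \<le> c * \<alpha> ^ n * fact n powr \<beta>))"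

definition gevrey_beurling_semigroup :: "real \<Rightarrow> (real \<Rightarrow> 'a::complex_banach \<Rightarrow> 'a) \<Rightarrow> bool"
  where "gevrey_beurling_semigroup \<beta> S \<longleftrightarrow>
    C0_semigroup S \<and> (\<forall>x. gevrey_beurling \<beta> (\<lambda>t. S t x))"

end

theory Submission
  imports Defs
begin

text \<open>Write \<open>\<Phi> F\<close> for the bounded operator \<open>\<integral> F dE\<close> of a bounded Borel function \<open>F\<close>, and \<open>\<sigma>\<close> for the
  spectrum of \<open>A\<close>. The theorem holds because the semigroup generated by \<open>A\<close> can only be
  \<open>S t = \<Phi> (exp (t z))\<close>, with derivatives \<open>\<Phi> (z ^ n * exp (t z))\<close>, and because the norm of \<open>\<Phi> F\<close> is
  comparable with the supremum of \<open>F\<close> on \<open>\<sigma>\<close> for continuous \<open>F\<close>. So the Gevrey estimates of the orbits are equivalent to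
  the estimates \<open>cmod z ^ n * exp (t * Re z) \<le> c * \<alpha> ^ n * fact n powr \<beta>\<close> on \<open>\<sigma>\<close>, for every \<open>\<alpha>\<close>.

  The functional calculus rests on a uniform bound for all projections \<open>E \<delta>\<close>. For a fixed vector it
  follows from countable additivity alone (\<open>bounded_orbit\<close>), and then the uniform boundedness
  principle applies. Hence \<open>\<Phi>\<close> is a multiplicative, bounded map that obeys dominated convergence.
  The unbounded \<open>A\<close> is handled through two identities: \<open>\<Phi> G (A x) = \<Phi> (z * G) x\<close> for \<open>x\<close> in the domain
  (\<open>\<Phi>_A\<close>), and \<open>A (\<Phi> G x) = \<Phi> (z * G) x\<close> for all \<open>x\<close> (\<open>A_\<Phi>\<close>), as soon as \<open>G\<close> and \<open>z * G\<close> are bounded.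

  From the region to the semigroup: the spectrum lies in a half-plane, so \<open>\<Phi> (exp (t z))\<close> is a
  \<open>C\<^sub>0\<close>-semigroup, and its generator is exactly \<open>A\<close> because the quotients \<open>(exp (h z) - 1) / (h z)\<close> are
  uniformly bounded and tend to \<open>1\<close> (\<open>generator_exp\<close>). On the region the exponential
  dominates the powers of \<open>z\<close>: the real part costs \<open>fact n\<close> only, and
  \<open>y ^ n * exp (- c * y powr (1 / \<beta>))\<close> costs \<open>fact n powr \<beta>\<close> with a geometric factor that is small when \<open>c\<close> is
  large (\<open>gevrey_estimate\<close>).

  From the semigroup to the region: for a bounded Borel set \<open>\<delta>\<close>, the vector
  \<open>\<Phi> (exp (- s z) * indicator \<delta>) (S s x)\<close> has derivative zero in \<open>s\<close>, which identifies \<open>E \<delta> (S t x)\<close> and all its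
  derivatives (\<open>E_semigroup\<close>). The constants of the Gevrey estimates depend on the orbit, but the
  uniform boundedness principle, over all \<open>n\<close> and \<open>\<delta>\<close> at once, makes them uniform. As \<open>E\<close> does not
  vanish near any point of the spectrum, the operator bound becomes a pointwise bound on \<open>\<sigma>\<close>
  (\<open>cmod_le_of_norm_\<Phi>_le\<close>). Summing the bounds at time \<open>1\<close> over \<open>n\<close> as an exponential series gives
  the region (\<open>region_of_gevrey_bound\<close>).\<close>

section \<open>Complex Banach spaces\<close>

lemma bounded_bilinear_scaleC:
  "bounded_bilinear (scaleC :: complex \<Rightarrow> 'a::complex_banach \<Rightarrow> 'a)"
proof
  fix r :: real and c :: complex and x :: 'a
  have "(complex_of_real r * c) *\<^sub>C x = r *\<^sub>R (c *\<^sub>C x)"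
    by (simp only: scaleC_scaleC[symmetric] scaleC_of_real)
  then show "(r *\<^sub>R c) *\<^sub>C x = r *\<^sub>R (c *\<^sub>C x)"
    by (simp add: scaleR_conv_of_real)
  have "(c * complex_of_real r) *\<^sub>C x = c *\<^sub>C (r *\<^sub>R x)"
    by (simp only: scaleC_scaleC[symmetric] scaleC_of_real)
  then show "c *\<^sub>C (r *\<^sub>R x) = r *\<^sub>R (c *\<^sub>C x)"
    using \<open>(complex_of_real r * c) *\<^sub>C x = r *\<^sub>R (c *\<^sub>C x)\<close> by (simp add: mult.commute)
  show "\<exists>K. \<forall>a b. norm ((a::complex) *\<^sub>C (b::'a)) \<le> norm a * norm b * K"
    by (rule exI[of _ 1]) (simp add: norm_scaleC)
qed (simp_all add: scaleC_add_left scaleC_add_right)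

interpretation scaleC: bounded_bilinear
  "scaleC :: complex \<Rightarrow> 'a::complex_banach \<Rightarrow> 'a"
  by (rule bounded_bilinear_scaleC)

lemma scaleC_one [simp]: "1 *\<^sub>C x = (x :: 'a::complex_banach)"
  using scaleC_of_real[of 1 x] by simp

lemma bounded_clinearI:
  fixes T :: "'a::complex_banach \<Rightarrow> 'a"
  assumes add: "\<And>x y. T (x + y) = T x + T y"
    and scale: "\<And>c x. T (c *\<^sub>C x) = c *\<^sub>C T x"
    and bound: "\<And>x. norm (T x) \<le> K * norm x"
  shows "bounded_clinear T"
  unfolding bounded_clinear_def
proof (intro conjI allI scale bounded_linear_intro[of T K])
  show "T (r *\<^sub>R x) = r *\<^sub>R T x" for r x
    using scale[of "complex_of_real r" x] by (simp add: scaleC_of_real)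
qed (use add bound in \<open>simp_all add: mult.commute\<close>)

section \<open>Uniform boundedness\<close>

text \<open>The Banach--Steinhaus theorem, by Baire category: one of the closed sets on which all the
  operators are bounded by \<open>n\<close> contains a ball.\<close>

lemma uniform_boundedness:
  fixes T :: "'i \<Rightarrow> 'a::banach \<Rightarrow> 'b::real_normed_vector"
  assumes lin: "\<And>i. i \<in> I \<Longrightarrow> bounded_linear (T i)"
    and pointwise: "\<And>x. \<exists>B. \<forall>i\<in>I. norm (T i x) \<le> B"
  shows "\<exists>M>0. \<forall>i\<in>I. \<forall>x. norm (T i x) \<le> M * norm x"
proof -
  define C where "C n = {x. \<forall>i\<in>I. norm (T i x) \<le> real n}" for n
  have closed: "closed (C n)" for n
  proof -
    have "C n = (\<Inter>i\<in>I. {x. norm (T i x) \<le> real n})"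
      by (auto simp: C_def)
    moreover have "closed {x. norm (T i x) \<le> real n}" if "i \<in> I" for i
      using lin[OF that]
      by (intro closed_Collect_le continuous_intros linear_continuous_on) simp_all
    ultimately show ?thesis by (simp add: closed_INT)
  qed
  have "(\<Union>n. C n) = UNIV"
  proof -
    have "\<exists>n. x \<in> C n" for x
    proof -
      obtain B where B: "\<forall>i\<in>I. norm (T i x) \<le> B" using pointwise by blast
      obtain n where "B \<le> real n" using real_arch_simple by blast
      with B have "x \<in> C n" unfolding C_def by force
      then show ?thesis ..
    qed
    then show ?thesis by blast
  qed
  have "\<exists>n. interior (C n) \<noteq> {}"
  proof (rule ccontr)
    assume "\<not> ?thesis"
    then have "euclidean interior_of (\<Union>(range C)) = {}"
      using closed by (intro Baire_category_alt)
        (auto simp: completely_metrizable_space_euclidean interior_of_def interior_def)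
    then show False using \<open>(\<Union>n. C n) = UNIV\<close>
      using interior_of_topspace[of "euclidean :: 'a topology"] by simp
  qed
  then obtain n x\<^sub>0 r where r: "r > 0" "ball x\<^sub>0 r \<subseteq> C n"
    by (auto simp: mem_interior)
  have "norm (T i x) \<le> (4 * real n / r + 1) * norm x" if "i \<in> I" for i x
  proof (cases "x = 0")
    case True
    then show ?thesis using lin[OF that] by (simp add: linear_simps)
  next
    case False
    define k where "k = r / (2 * norm x)"
    have k: "k > 0" using r False by (simp add: k_def)
    have "x\<^sub>0 + k *\<^sub>R x \<in> ball x\<^sub>0 r"
      using r False by (simp add: dist_norm k_def)
    moreover have "x\<^sub>0 \<in> ball x\<^sub>0 r" using r by simp
    ultimately have "norm (T i (x\<^sub>0 + k *\<^sub>R x)) \<le> real n" "norm (T i x\<^sub>0) \<le> real n"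
      using r(2) that unfolding C_def by blast+
    moreover have "k *\<^sub>R T i x = T i (x\<^sub>0 + k *\<^sub>R x) - T i x\<^sub>0"
      using lin[OF that] by (simp add: linear_simps)
    ultimately have "norm (k *\<^sub>R T i x) \<le> real n + real n"
      by (metis (mono_tags) norm_triangle_ineq4 add_mono order_trans)
    then have "norm (T i x) \<le> (2 * real n) / k"
      using k by (simp add: field_simps)
    also have "\<dots> = (4 * real n / r) * norm x"
      by (simp add: k_def)
    also have "\<dots> \<le> (4 * real n / r + 1) * norm x"
      by (simp add: algebra_simps)
    finally show ?thesis .
  qed
  moreover have "4 * real n / r + 1 > 0"
    using r by (intro add_nonneg_pos) auto
  ultimately show ?thesis by blast
qed

text \<open>The norm is convex, and a convex function on a cube attains its maximum at a vertex: a bound for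
  all partial sums of \<open>e\<close> is a bound for all sums with weights in the unit interval. The offset \<open>u\<close>
  carries the induction. Applied to orthogonal spectral projections, it bounds the
  integral of a simple function by the norm of a single projection.\<close>

lemma norm_weighted_sum_le:
  fixes e :: "'i \<Rightarrow> 'a::real_normed_vector"
  assumes "finite V" "\<And>W. W \<subseteq> V \<Longrightarrow> norm (u + (\<Sum>v\<in>W. e v)) \<le> B"
    and "\<And>v. v \<in> V \<Longrightarrow> 0 \<le> c v \<and> c v \<le> 1"
  shows "norm (u + (\<Sum>v\<in>V. c v *\<^sub>R e v)) \<le> B"
  using assms
proof (induction V arbitrary: u rule: finite_induct)
  case empty
  then show ?case by (metis subset_refl sum.empty)
next
  case (insert v V)
  let ?S = "\<Sum>v\<in>V. c v *\<^sub>R e v"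
  have 1: "norm (u + ?S) \<le> B"
    using insert.prems by (intro insert.IH) auto
  have 2: "norm ((u + e v) + ?S) \<le> B"
  proof (intro insert.IH)
    fix W assume W: "W \<subseteq> V"
    then have "v \<notin> W" "finite W" using insert.hyps finite_subset by auto
    then have "u + e v + sum e W = u + sum e (insert v W)" by (simp add: add.assoc)
    moreover have "norm (u + sum e (insert v W)) \<le> B"
      using W by (intro insert.prems(1)) auto
    ultimately show "norm (u + e v + sum e W) \<le> B" by (simp only:)
  qed (use insert.prems in auto)
  have c: "0 \<le> c v" "c v \<le> 1" using insert.prems(2) by auto
  have "u + (\<Sum>v\<in>insert v V. c v *\<^sub>R e v) = (1 - c v) *\<^sub>R (u + ?S) + c v *\<^sub>R ((u + e v) + ?S)"
    using insert.hyps by (simp add: algebra_simps)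
  also have "norm \<dots> \<le> (1 - c v) * norm (u + ?S) + c v * norm ((u + e v) + ?S)"
    using c by (intro order_trans[OF norm_triangle_ineq]) simp
  also have "\<dots> \<le> (1 - c v) * B + c v * B"
    using c 1 2 by (intro add_mono mult_left_mono) auto
  finally show ?case by (simp add: algebra_simps)
qed

section \<open>Resolvents\<close>

lemma resolvent_setI:
  assumes "bounded_clinear R"
    and right: "\<And>y. R y \<in> D \<and> A (R y) - z *\<^sub>C R y = y"
    and left: "\<And>x. x \<in> D \<Longrightarrow> R (A x - z *\<^sub>C x) = x"
  shows "z \<in> resolvent_set D A"
proof -
  let ?f = "\<lambda>x. A x - z *\<^sub>C x"
  have bij: "bij_betw ?f D UNIV"
    by (rule bij_betw_byWitness[where f' = R]) (use right left in auto)
  have "inv_into D ?f y = R y" for y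
  proof -
    have "inj_on ?f D" using bij by (rule bij_betw_imp_inj_on)
    from inv_into_f_f[OF this, of "R y"] right[of y] show ?thesis by simp
  qed
  then have "inv_into D ?f = R" ..
  then show ?thesis
    using bij assms(1) by (simp add: resolvent_set_def)
qed

text \<open>The Neumann series argument, with the inverse of \<open>1 - (w - z) R\<close> obtained as the fixed point of a
  contraction: \<open>A - w = (1 - (w - z) R) (A - z)\<close>.\<close>

lemma (in densely_defined_closed_operator) resolvent_perturbation:
  assumes R: "bounded_clinear R"
    and right: "\<And>y. R y \<in> D \<and> A (R y) - z *\<^sub>C R y = y"
    and left: "\<And>x. x \<in> D \<Longrightarrow> R (A x - z *\<^sub>C x) = x"
    and K: "\<And>x. norm (R x) \<le> K * norm x" "K > 0"
    and w: "cmod (w - z) * K < 1"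
  shows "w \<in> resolvent_set D A"
proof -
  interpret R: bounded_linear R using R by (simp add: bounded_clinear_def)
  have Rc: "R (c *\<^sub>C x) = c *\<^sub>C R x" for c x using R by (simp add: bounded_clinear_def)
  define d q where "d = w - z" and "q = cmod (w - z) * K"
  have q: "0 \<le> q" "q < 1" using K w by (auto simp: q_def)
  have Tq: "norm (d *\<^sub>C R u) \<le> q * norm u" for u
    using K(1)[of u] unfolding norm_scaleC q_def d_def mult.assoc
    by (intro mult_left_mono) auto
  have ex: "\<exists>!u. y + d *\<^sub>C R u = u" for y
  proof (rule banach_fix_type[OF q], intro allI)
    fix u v
    have "dist (y + d *\<^sub>C R u) (y + d *\<^sub>C R v) = norm (d *\<^sub>C R (u - v))"
      by (simp add: dist_norm R.diff scaleC.diff_right)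
    then show "dist (y + d *\<^sub>C R u) (y + d *\<^sub>C R v) \<le> q * dist u v"
      using Tq[of "u - v"] by (simp add: dist_norm)
  qed
  define N where "N y = (THE u. y + d *\<^sub>C R u = u)" for y
  have N: "y + d *\<^sub>C R (N y) = N y" for y
    unfolding N_def using theI'[OF ex[of y]] .
  have N_unique: "N y = u" if "y + d *\<^sub>C R u = u" for y u
    using ex[of y] that N[of y] by blast
  have "bounded_clinear N"
  proof (rule bounded_clinearI)
    show "N (x + y) = N x + N y" for x y
      using arg_cong2[where f = "(+)", OF N[of x] N[of y]]
      by (intro N_unique) (simp add: R.add scaleC_add_right add_ac)
    show "N (c *\<^sub>C x) = c *\<^sub>C N x" for c x
    proof (rule N_unique)
      have "c *\<^sub>C x + d *\<^sub>C R (c *\<^sub>C N x) = c *\<^sub>C (x + d *\<^sub>C R (N x))"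
        by (simp add: Rc scaleC_add_right scaleC_scaleC mult.commute)
      then show "c *\<^sub>C x + d *\<^sub>C R (c *\<^sub>C N x) = c *\<^sub>C N x" by (simp add: N)
    qed
    fix y
    have "norm (N y) \<le> norm y + norm (d *\<^sub>C R (N y))"
      by (metis N norm_triangle_ineq)
    also have "\<dots> \<le> norm y + q * norm (N y)" using Tq by simp
    finally show "norm (N y) \<le> (1 / (1 - q)) * norm y"
      using q by (simp add: field_simps)
  qed
  have RN: "R (N y) = R y + d *\<^sub>C R (R (N y))" for y
    by (metis N R.add Rc)
  have "bounded_clinear (\<lambda>y. R (N y))"
    using R \<open>bounded_clinear N\<close> by (auto simp: bounded_clinear_def intro: bounded_linear_compose)
  moreover have "R (N y) \<in> D \<and> A (R (N y)) - w *\<^sub>C R (N y) = y" for y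
  proof -
    have "A (R (N y)) = N y + z *\<^sub>C R (N y)" using right[of "N y"] by (simp add: algebra_simps)
    then have "A (R (N y)) - w *\<^sub>C R (N y) = N y - d *\<^sub>C R (N y)"
      by (simp add: d_def scaleC.diff_left)
    also have "\<dots> = y" using N[of y] by (metis add_diff_cancel)
    finally show ?thesis using right by blast
  qed
  moreover have "R (N (A x - w *\<^sub>C x)) = x" if "x \<in> D" for x
  proof -
    have "N (A x - w *\<^sub>C x) = A x - z *\<^sub>C x"
      using left[OF that] by (intro N_unique) (simp add: R.diff Rc d_def scaleC.diff_left)
    then show ?thesis using left[OF that] by simp
  qed
  ultimately show ?thesis by (rule resolvent_setI)
qed

text \<open>This makes the spectrum a Borel set, on which \<open>E\<close> is meaningful.\<close>

lemma (in densely_defined_closed_operator) closed_spectrum: "closed (spectrum D A)"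
  unfolding spectrum_def closed_def double_compl open_dist
proof
  fix z assume "z \<in> resolvent_set D A"
  let ?f = "\<lambda>x. A x - z *\<^sub>C x"
  from \<open>z \<in> resolvent_set D A\<close> have bij: "bij_betw ?f D UNIV"
    and R: "bounded_clinear (inv_into D ?f)" by (simp_all add: resolvent_set_def)
  obtain K where K: "K > 0" "\<And>x. norm (inv_into D ?f x) \<le> K * norm x"
    using R bounded_linear.pos_bounded
    unfolding bounded_clinear_def by (metis mult.commute)
  show "\<exists>e>0. \<forall>w. dist w z < e \<longrightarrow> w \<in> resolvent_set D A"
  proof (intro exI[of _ "1 / K"] conjI allI impI)
    fix w assume "dist w z < 1 / K"
    then have w: "cmod (w - z) * K < 1" using K(1) by (simp add: dist_norm field_simps)
    show "w \<in> resolvent_set D A"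
    proof (rule resolvent_perturbation[OF R _ _ K(2,1) w])
      show "inv_into D ?f y \<in> D \<and> ?f (inv_into D ?f y) = y" for y
        using bij by (metis (no_types, lifting) UNIV_I bij_betw_def f_inv_into_f inv_into_into)
      show "inv_into D ?f (?f x) = x" if "x \<in> D" for x
        using bij that by (metis (no_types, lifting) bij_betw_inv_into_left)
    qed
  qed (use K in simp)
qed


section \<open>Spectral measures\<close>

context spectral_measure
begin

lemma bounded_linear_E: "\<delta> \<in> sets borel \<Longrightarrow> bounded_linear (E \<delta>)"
  using bounded by (simp add: bounded_clinear_def)

lemma E_scaleC: "\<delta> \<in> sets borel \<Longrightarrow> E \<delta> (c *\<^sub>C x) = c *\<^sub>C E \<delta> x"
  using bounded by (simp add: bounded_clinear_def)

lemma E_Int: "\<delta> \<in> sets borel \<Longrightarrow> \<eta> \<in> sets borel \<Longrightarrow> E \<delta> (E \<eta> x) = E (\<delta> \<inter> \<eta>) x"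
  by (simp add: inter)

lemma E_UNIV: "E UNIV x = x"
  by (simp add: whole)

lemma E_empty: "E {} x = 0"
  using compl[of UNIV x] by (simp add: E_UNIV)

lemma E_Un:
  assumes [measurable]: "\<delta> \<in> sets borel" "\<eta> \<in> sets borel" and "\<delta> \<inter> \<eta> = {}"
  shows "E (\<delta> \<union> \<eta>) x = E \<delta> x + E \<eta> x"
proof -
  interpret bounded_linear "E \<delta>" by (rule bounded_linear_E) simp
  have "E (- (- \<delta> \<inter> - \<eta>)) x = x - E (- \<delta>) (E (- \<eta>) x)"
    by (subst compl) (simp_all add: E_Int)
  also have "\<dots> = E \<delta> x + E \<eta> x - E (\<delta> \<inter> \<eta>) x"
    by (simp add: compl diff E_Int)
  finally show ?thesis using assms(3) by (simp add: E_empty)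
qed

lemma E_Diff:
  assumes "\<delta> \<in> sets borel" "\<eta> \<in> sets borel" "\<eta> \<subseteq> \<delta>"
  shows "E (\<delta> - \<eta>) x = E \<delta> x - E \<eta> x"
proof -
  have "E ((\<delta> - \<eta>) \<union> \<eta>) x = E (\<delta> - \<eta>) x + E \<eta> x"
    using assms(1,2) by (intro E_Un) auto
  moreover have "(\<delta> - \<eta>) \<union> \<eta> = \<delta>" using assms(3) by blast
  ultimately show ?thesis by simp
qed

lemma E_finite_UN:
  assumes "finite I" "\<And>i. i \<in> I \<Longrightarrow> A i \<in> sets borel" "disjoint_family_on A I"
  shows "E (\<Union>i\<in>I. A i) x = (\<Sum>i\<in>I. E (A i) x)"
  using assms
proof (induction I rule: finite_induct)
  case (insert i I)
  have "E (A i \<union> (\<Union>j\<in>I. A j)) x = E (A i) x + E (\<Union>j\<in>I. A j) x"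
    using insert.prems insert.hyps
    by (intro E_Un) (auto simp: disjoint_family_on_def intro!: sets.finite_UN)
  then show ?case
    using insert by (auto simp: disjoint_family_on_def)
qed (simp add: E_empty)

lemma E_increasing:
  assumes A: "\<And>n. A n \<in> sets borel" "mono A"
  shows "(\<lambda>n. E (A n) x) \<longlonglongrightarrow> E (\<Union>n. A n) x"
proof -
  have sums: "(\<lambda>n. E (disjointed A n) x) sums E (\<Union>n. disjointed A n) x"
    using A sets.range_disjointed_sets[of A borel]
    by (intro countably_additive) (auto simp: disjoint_family_disjointed)
  have partial_sum: "(\<Sum>i<Suc n. E (disjointed A i) x) = E (A n) x" for n
  proof -
    have "(\<Sum>i<Suc n. E (disjointed A i) x) = E (\<Union>i<Suc n. disjointed A i) x"
      using A sets.range_disjointed_sets[of A borel] disjoint_family_disjointed[of A]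
      by (intro E_finite_UN[symmetric]) (auto simp: disjoint_family_on_def)
    also have "(\<Union>i<Suc n. disjointed A i) = (\<Union>i<Suc n. A i)"
      using finite_UN_disjointed_eq[of A "Suc n"] by (simp add: atLeast0LessThan)
    also have "(\<Union>i<Suc n. A i) = A n"
      by (auto simp: less_Suc_eq_le) (metis monoD[OF \<open>mono A\<close>] subsetD)
    finally show ?thesis .
  qed
  from LIMSEQ_Suc[OF sums[unfolded sums_def UN_disjointed_eq]] show ?thesis
    unfolding partial_sum .
qed

lemma E_decreasing_empty:
  assumes A: "\<And>n. A n \<in> sets borel" "antimono A" "(\<Inter>n. A n) = {}"
  shows "(\<lambda>n. E (A n) x) \<longlonglongrightarrow> 0"
proof -
  have "(\<lambda>n. E (- A n) x) \<longlonglongrightarrow> E (\<Union>n. - A n) x"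
    using A by (intro E_increasing) (auto simp: mono_def antimono_def)
  moreover have "(\<Union>n. - A n) = UNIV" using A(3) by blast
  ultimately have "(\<lambda>n. x - E (- A n) x) \<longlonglongrightarrow> x - x"
    by (intro tendsto_diff tendsto_const) (simp add: E_UNIV)
  then show ?thesis using A by (simp add: compl)
qed

text \<open>A countably additive vector measure is bounded. Otherwise one can repeatedly cut a set on which it
  is unbounded into two parts, both of measure at least \<open>1\<close> in norm, one of which is again unbounded. The parts
  cut off are disjoint, and the series of their measures does not converge.\<close>

lemma bounded_orbit: "\<exists>B. \<forall>\<delta>\<in>sets borel. norm (E \<delta> x) \<le> B"
proof (rule ccontr)
  define small where
    "small \<delta> \<longleftrightarrow> (\<exists>B. \<forall>\<eta>\<in>sets borel. \<eta> \<subseteq> \<delta> \<longrightarrow> norm (E \<eta> x) \<le> B)" for \<delta>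
  let ?big = "\<lambda>\<delta>. \<delta> \<in> sets borel \<and> \<not> small \<delta>"
  assume "\<not> ?thesis"
  then have UNIV: "?big UNIV" by (simp add: small_def)
  have small_Un: "small \<delta>"
    if meas: "\<delta> \<in> sets borel" "\<eta> \<in> sets borel" and small: "small \<eta>" "small (\<delta> - \<eta>)" for \<delta> \<eta>
  proof -
    obtain B where B: "\<And>\<zeta>. \<zeta> \<in> sets borel \<Longrightarrow> \<zeta> \<subseteq> \<eta> \<Longrightarrow> norm (E \<zeta> x) \<le> B"
      using small(1) unfolding small_def by blast
    obtain B' where B': "\<And>\<zeta>. \<zeta> \<in> sets borel \<Longrightarrow> \<zeta> \<subseteq> \<delta> - \<eta> \<Longrightarrow> norm (E \<zeta> x) \<le> B'"
      using small(2) unfolding small_def by blast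
    have "norm (E \<zeta> x) \<le> B + B'" if \<zeta>: "\<zeta> \<in> sets borel" "\<zeta> \<subseteq> \<delta>" for \<zeta>
    proof -
      have "E ((\<zeta> \<inter> \<eta>) \<union> (\<zeta> - \<eta>)) x = E (\<zeta> \<inter> \<eta>) x + E (\<zeta> - \<eta>) x"
        using \<zeta> meas by (intro E_Un) auto
      moreover have "(\<zeta> \<inter> \<eta>) \<union> (\<zeta> - \<eta>) = \<zeta>" by blast
      ultimately have "norm (E \<zeta> x) \<le> norm (E (\<zeta> \<inter> \<eta>) x) + norm (E (\<zeta> - \<eta>) x)"
        using norm_triangle_ineq by metis
      also have "\<dots> \<le> B + B'"
        using \<zeta> meas by (intro add_mono B B') auto
      finally show ?thesis .
    qed
    then show ?thesis unfolding small_def by blast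
  qed
  \<comment> \<open>If \<open>E \<eta> x\<close> exceeds \<open>E \<delta> x\<close> by \<open>1\<close> in norm, then \<open>E\<close> is large on \<open>\<eta>\<close> and on its complement in \<open>\<delta>\<close>.\<close>
  have step: "\<exists>\<delta>'. ?big \<delta>' \<and> \<delta>' \<subseteq> \<delta> \<and> norm (E (\<delta> - \<delta>') x) \<ge> 1" if \<delta>: "?big \<delta>" for \<delta>
  proof -
    obtain \<eta> where \<eta>: "\<eta> \<in> sets borel" "\<eta> \<subseteq> \<delta>" "norm (E \<eta> x) > norm (E \<delta> x) + 1"
      using \<delta> unfolding small_def by (meson not_le)
    have "E (\<delta> - \<eta>) x = E \<delta> x - E \<eta> x" using \<delta> \<eta> by (intro E_Diff) auto
    then have "norm (E (\<delta> - \<eta>) x) \<ge> 1"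
      using norm_triangle_ineq2[of "E \<eta> x" "E \<delta> x"] \<eta>(3) by (simp add: norm_minus_commute)
    moreover have "norm (E (\<delta> - (\<delta> - \<eta>)) x) \<ge> 1"
    proof -
      have "\<delta> - (\<delta> - \<eta>) = \<eta>" using \<eta>(2) by blast
      then show ?thesis using \<eta>(3) norm_ge_zero[of "E \<delta> x"] by (simp only:)
    qed
    moreover have "\<not> small \<eta> \<or> \<not> small (\<delta> - \<eta>)"
      using small_Un[of \<delta> \<eta>] \<delta> \<eta>(1) by blast
    ultimately show ?thesis using \<delta> \<eta>(1,2) by (metis Diff_subset sets.Diff)
  qed
  obtain \<delta> where \<delta>: "\<And>n. ?big (\<delta> n)"
    "\<And>n. \<delta> (Suc n) \<subseteq> \<delta> n" "\<And>n. norm (E (\<delta> n - \<delta> (Suc n)) x) \<ge> 1"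
    using dependent_nat_choice[of "\<lambda>_. ?big"
        "\<lambda>_ \<delta> \<delta>'. \<delta>' \<subseteq> \<delta> \<and> norm (E (\<delta> - \<delta>') x) \<ge> 1"] UNIV step by metis
  have anti: "\<delta> m \<subseteq> \<delta> n" if "n \<le> m" for m n
    using that \<delta>(2) by (rule lift_Suc_antimono_le[rotated])
  have "disjoint_family (\<lambda>n. \<delta> n - \<delta> (Suc n))"
  proof -
    have "(\<delta> m - \<delta> (Suc m)) \<inter> (\<delta> n - \<delta> (Suc n)) = {}" if "m < n" for m n
      using anti[of "Suc m" n] that by auto
    then show ?thesis
      unfolding disjoint_family_on_def by (metis Int_commute linorder_neqE_nat)
  qed
  then have "(\<lambda>n. E (\<delta> n - \<delta> (Suc n)) x) sums E (\<Union>n. \<delta> n - \<delta> (Suc n)) x"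
    using \<delta>(1) by (intro countably_additive) auto
  then have "(\<lambda>n. E (\<delta> n - \<delta> (Suc n)) x) \<longlonglongrightarrow> 0"
    using sums_summable summable_LIMSEQ_zero by blast
  then have "\<forall>\<^sub>F n in sequentially. norm (E (\<delta> n - \<delta> (Suc n)) x) < 1"
    using order_tendstoD(2)[OF tendsto_norm_zero, of _ sequentially 1] by simp
  then obtain n where "norm (E (\<delta> n - \<delta> (Suc n)) x) < 1"
    by (auto simp: eventually_sequentially)
  with \<delta>(3)[of n] show False by simp
qed

definition projection_bound :: real
  where "projection_bound = (SOME M. M > 0 \<and> (\<forall>\<delta>\<in>sets borel. \<forall>x. norm (E \<delta> x) \<le> M * norm x))"

lemma projection_bound_pos: "projection_bound > 0"
  and norm_E_le: "\<delta> \<in> sets borel \<Longrightarrow> norm (E \<delta> x) \<le> projection_bound * norm x"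
proof -
  have "\<exists>M>0. \<forall>\<delta>\<in>sets borel. \<forall>x. norm (E \<delta> x) \<le> M * norm x"
    by (intro uniform_boundedness bounded_linear_E bounded_orbit)
  then have "projection_bound > 0 \<and>
      (\<forall>\<delta>\<in>sets borel. \<forall>x. norm (E \<delta> x) \<le> projection_bound * norm x)"
    unfolding projection_bound_def by (rule someI_ex)
  then show "projection_bound > 0"
    "\<delta> \<in> sets borel \<Longrightarrow> norm (E \<delta> x) \<le> projection_bound * norm x" by auto
qed

section \<open>Integrals of simple functions\<close>

lemma simple_vimage: "simple_function borel s \<Longrightarrow> s -` B \<in> sets borel"
  using simple_functionD(2)[of borel s B] by simp

lemma simple_finite_range: "simple_function borel s \<Longrightarrow> finite (range s)"
  using simple_functionD(1)[of borel s] by simp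

text \<open>Two simple functions have a common refinement, such as the pair of them. Computing integrals
  along any simple \<open>p\<close> through which the integrand factors makes the algebraic laws below sums over one
  common partition.\<close>

lemma simple_integral_refine:
  assumes p: "simple_function borel p" and V: "finite V" "range p \<subseteq> V"
  shows "simple_spectral_integral E (\<lambda>z. f (p z)) x = (\<Sum>v\<in>V. f v *\<^sub>C E (p -` {v}) x)"
proof -
  have fin: "finite (range p)" using V finite_subset by blast
  have "(\<Sum>v\<in>V. f v *\<^sub>C E (p -` {v}) x) = (\<Sum>v\<in>range p. f v *\<^sub>C E (p -` {v}) x)"
  proof (rule sum.mono_neutral_right[OF V], rule ballI)
    fix v assume "v \<in> V - range p"
    then have "p -` {v} = {}" by auto
    then show "f v *\<^sub>C E (p -` {v}) x = 0" by (simp add: E_empty scaleC.zero_right)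
  qed
  also have "\<dots> = (\<Sum>c\<in>f ` range p. \<Sum>v | v \<in> range p \<and> f v = c. f v *\<^sub>C E (p -` {v}) x)"
    by (rule sum.image_gen[OF fin])
  also have "\<dots> = (\<Sum>c\<in>f ` range p. c *\<^sub>C E ((\<lambda>z. f (p z)) -` {c}) x)"
  proof (rule sum.cong[OF refl])
    fix c
    have "(\<lambda>z. f (p z)) -` {c} = (\<Union>v\<in>{v \<in> range p. f v = c}. p -` {v})" by auto
    then have "E ((\<lambda>z. f (p z)) -` {c}) x = (\<Sum>v | v \<in> range p \<and> f v = c. E (p -` {v}) x)"
      using fin p by (simp only:, intro E_finite_UN) (auto simp: disjoint_family_on_def simple_vimage)
    then show "(\<Sum>v | v \<in> range p \<and> f v = c. f v *\<^sub>C E (p -` {v}) x) = c *\<^sub>C E ((\<lambda>z. f (p z)) -` {c}) x"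
      by (simp add: scaleC.sum_right)
  qed
  finally show ?thesis
    by (simp add: simple_spectral_integral_def image_image)
qed

lemma simple_integral_add:
  assumes "simple_function borel s" "simple_function borel t"
  shows "simple_spectral_integral E (\<lambda>z. s z + t z) x =
    simple_spectral_integral E s x + simple_spectral_integral E t x"
proof -
  let ?p = "\<lambda>z. (s z, t z)"
  have p: "simple_function borel ?p" using assms by (rule simple_function_Pair)
  note refine = simple_integral_refine[OF p simple_finite_range[OF p] subset_refl]
  show ?thesis
    using refine[of fst x] refine[of snd x] refine[of "\<lambda>(a, b). a + b" x]
    by (simp add: sum.distrib[symmetric] scaleC_add_left[symmetric] case_prod_beta)
qed

lemma simple_integral_scale:
  assumes "simple_function borel s"
  shows "simple_spectral_integral E (\<lambda>z. c * s z) x = c *\<^sub>C simple_spectral_integral E s x"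
  using simple_integral_refine[OF assms simple_finite_range[OF assms] subset_refl, of "\<lambda>v. c * v" x]
    simple_integral_refine[OF assms simple_finite_range[OF assms] subset_refl, of "\<lambda>v. v" x]
  by (simp add: scaleC.sum_right scaleC_scaleC)

lemma simple_integral_diff:
  assumes "simple_function borel s" "simple_function borel t"
  shows "simple_spectral_integral E (\<lambda>z. s z - t z) x =
    simple_spectral_integral E s x - simple_spectral_integral E t x"
  using simple_integral_add[OF assms(1) simple_function_compose1[OF assms(2), of "\<lambda>v. - 1 * v"], of x]
    simple_integral_scale[OF assms(2), of "- 1" x]
  by (simp add: scaleC.minus_left)

text \<open>Multiplicativity comes from the orthogonality of projections on disjoint sets.\<close>

lemma simple_integral_mult:
  assumes "simple_function borel s" "simple_function borel t"
  shows "simple_spectral_integral E (\<lambda>z. s z * t z) x =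
    simple_spectral_integral E s (simple_spectral_integral E t x)"
proof -
  let ?p = "\<lambda>z. (s z, t z)" and ?V = "range (\<lambda>z. (s z, t z))"
  have p: "simple_function borel ?p" using assms by (rule simple_function_Pair)
  have fin: "finite ?V" by (rule simple_finite_range[OF p])
  note refine = simple_integral_refine[OF p fin subset_refl]
  have meas: "?p -` B \<in> sets borel" for B by (rule simple_vimage[OF p])
  have orth: "E (?p -` {v}) (E (?p -` {w}) x) = (if w = v then E (?p -` {v}) x else 0)" for v w
  proof -
    have "?p -` {v} \<inter> ?p -` {w} = (if w = v then ?p -` {v} else {})" by auto
    then show ?thesis using E_Int[OF meas meas, of "{v}" "{w}" x] by (simp add: E_empty)
  qed
  have "simple_spectral_integral E s (simple_spectral_integral E t x) =
      (\<Sum>v\<in>?V. fst v *\<^sub>C E (?p -` {v}) (\<Sum>w\<in>?V. snd w *\<^sub>C E (?p -` {w}) x))"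
    using refine[of snd x] refine[of fst] by simp
  also have "\<dots> = (\<Sum>v\<in>?V. fst v *\<^sub>C (snd v *\<^sub>C E (?p -` {v}) x))"
  proof (rule sum.cong[OF refl])
    fix v assume v: "v \<in> ?V"
    interpret bounded_linear "E (?p -` {v})" by (rule bounded_linear_E[OF meas])
    have "E (?p -` {v}) (\<Sum>w\<in>?V. snd w *\<^sub>C E (?p -` {w}) x) =
        (\<Sum>w\<in>?V. if w = v then snd v *\<^sub>C E (?p -` {v}) x else 0)"
      unfolding sum E_scaleC[OF meas] orth
      by (intro sum.cong refl) (simp add: scaleC.zero_right)
    also have "\<dots> = snd v *\<^sub>C E (?p -` {v}) x"
      using fin v by (simp add: sum.delta)
    finally show "fst v *\<^sub>C E (?p -` {v}) (\<Sum>w\<in>?V. snd w *\<^sub>C E (?p -` {w}) x) =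
        fst v *\<^sub>C (snd v *\<^sub>C E (?p -` {v}) x)" by simp
  qed
  also have "\<dots> = simple_spectral_integral E (\<lambda>z. s z * t z) x"
    using refine[of "\<lambda>v. fst v * snd v" x] by (simp add: scaleC_scaleC)
  finally show ?thesis ..
qed

lemma simple_integral_indicator:
  assumes "\<delta> \<in> sets borel"
  shows "simple_spectral_integral E (indicator \<delta>) x = E \<delta> x"
proof -
  let ?p = "indicator \<delta> :: complex \<Rightarrow> complex"
  have p: "simple_function borel ?p" using assms by simp
  have V: "finite {0, 1::complex}" "range ?p \<subseteq> {0, 1}" by (auto simp: indicator_def)
  have "?p -` {1} = \<delta>" by (auto simp: indicator_def)
  then show ?thesis
    using simple_integral_refine[OF p V, of "\<lambda>v. v" x]
    by (simp add: scaleC.zero_left)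
qed

lemma simple_integral_linear:
  assumes "simple_function borel s"
  shows "simple_spectral_integral E s (x + y) =
      simple_spectral_integral E s x + simple_spectral_integral E s y"
    and "simple_spectral_integral E s (c *\<^sub>C x) = c *\<^sub>C simple_spectral_integral E s x"
proof -
  have "bounded_linear (E (s -` {c}))" for c
    using assms by (intro bounded_linear_E simple_vimage)
  then show "simple_spectral_integral E s (x + y) =
      simple_spectral_integral E s x + simple_spectral_integral E s y"
    by (simp add: simple_spectral_integral_def linear_simps scaleC_add_right sum.distrib)
  show "simple_spectral_integral E s (c *\<^sub>C x) = c *\<^sub>C simple_spectral_integral E s x"
    using assms
    by (simp add: simple_spectral_integral_def E_scaleC simple_vimage scaleC.sum_right
        scaleC_scaleC mult.commute)
qed

text \<open>Partial sums of the projections on disjoint sets are again projections, so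
  \<open>norm_weighted_sum_le\<close> applies with a bound that does not grow with the number of values.\<close>

lemma norm_weighted_projections_le:
  assumes s: "simple_function borel s" and c: "\<And>v. 0 \<le> c v \<and> c v \<le> K"
  shows "norm (\<Sum>v\<in>range s. c v *\<^sub>R E (s -` {v}) x) \<le> K * projection_bound * norm x"
proof -
  consider "K > 0" | "K = 0" using c[of undefined] by force
  then show ?thesis
  proof cases
    case 1
    have "norm (0 + (\<Sum>v\<in>range s. (c v / K) *\<^sub>R E (s -` {v}) x)) \<le> projection_bound * norm x"
    proof (rule norm_weighted_sum_le)
      fix W assume W: "W \<subseteq> range s"
      have "(\<Sum>v\<in>W. E (s -` {v}) x) = E (\<Union>v\<in>W. s -` {v}) x"
        using W s finite_subset[OF W simple_finite_range[OF s]]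
        by (intro E_finite_UN[symmetric]) (auto simp: disjoint_family_on_def simple_vimage)
      moreover have "(\<Union>v\<in>W. s -` {v}) = s -` W" by auto
      ultimately show "norm (0 + (\<Sum>v\<in>W. E (s -` {v}) x)) \<le> projection_bound * norm x"
        using norm_E_le[OF simple_vimage[OF s]] by simp
    qed (use 1 c s in \<open>auto simp: simple_finite_range divide_le_eq\<close>)
    then have "K * norm (\<Sum>v\<in>range s. (c v / K) *\<^sub>R E (s -` {v}) x) \<le> K * (projection_bound * norm x)"
      using 1 by simp
    moreover have "(\<Sum>v\<in>range s. c v *\<^sub>R E (s -` {v}) x) =
        K *\<^sub>R (\<Sum>v\<in>range s. (c v / K) *\<^sub>R E (s -` {v}) x)"
      using 1 by (simp add: scaleR_sum_right)
    ultimately show ?thesis using 1 by (simp add: mult.assoc)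
  next
    case 2
    then have "c v = 0" for v using c[of v] by simp
    then show ?thesis using 2 by simp
  qed
qed

text \<open>The factor \<open>4\<close> counts the positive and negative parts of the real and the imaginary part.\<close>

lemma norm_simple_integral_le:
  assumes s: "simple_function borel s" and K: "\<And>z. cmod (s z) \<le> K"
  shows "norm (simple_spectral_integral E s x) \<le> 4 * projection_bound * K * norm x"
proof -
  let ?S = "\<lambda>c. \<Sum>v\<in>range s. c v *\<^sub>R E (s -` {v}) x"
  have split: "v *\<^sub>C y = max (Re v) 0 *\<^sub>R y - max (- Re v) 0 *\<^sub>R y
      + \<i> *\<^sub>C (max (Im v) 0 *\<^sub>R y - max (- Im v) 0 *\<^sub>R y)" for v and y :: 'a
  proof -
    have "v *\<^sub>C y = (complex_of_real (Re v) + \<i> * complex_of_real (Im v)) *\<^sub>C y"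
      by (subst complex_eq) simp
    also have "\<dots> = Re v *\<^sub>R y + \<i> *\<^sub>C (Im v *\<^sub>R y)"
      by (simp add: scaleC_add_left scaleC_of_real flip: scaleC_scaleC)
    also have "Re v = max (Re v) 0 - max (- Re v) 0" by simp
    also have "Im v = max (Im v) 0 - max (- Im v) 0" by simp
    finally show ?thesis by (simp add: scaleR_left_diff_distrib)
  qed
  have "simple_spectral_integral E s x =
      (?S (\<lambda>v. max (Re v) 0) - ?S (\<lambda>v. max (- Re v) 0))
      + \<i> *\<^sub>C (?S (\<lambda>v. max (Im v) 0) - ?S (\<lambda>v. max (- Im v) 0))"
    unfolding simple_spectral_integral_def
    by (subst split) (simp add: sum.distrib sum_subtractf scaleC.diff_right scaleC.sum_right)
  then have "norm (simple_spectral_integral E s x) \<le>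
      (norm (?S (\<lambda>v. max (Re v) 0)) + norm (?S (\<lambda>v. max (- Re v) 0)))
      + (norm (?S (\<lambda>v. max (Im v) 0)) + norm (?S (\<lambda>v. max (- Im v) 0)))"
    by (simp only:, intro order_trans[OF norm_triangle_ineq] add_mono)
      (simp_all add: norm_scaleC norm_triangle_ineq4)
  also have "\<dots> \<le> (K * projection_bound * norm x + K * projection_bound * norm x)
      + (K * projection_bound * norm x + K * projection_bound * norm x)"
  proof -
    have K0: "0 \<le> K" using K[of 0] norm_ge_zero order_trans by blast
    \<comment> \<open>Only the values of \<open>s\<close> matter, so a coefficient may be cut off at \<open>K\<close>.\<close>
    have trunc: "?S c = ?S (\<lambda>v. min (c v) K)" if "\<And>v. c v \<le> cmod v \<or> c v \<le> 0" for c
    proof (rule sum.cong[OF refl])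
      fix v assume "v \<in> range s"
      then obtain z where "v = s z" by blast
      then have "c v \<le> K" using that[of v] K[of z] K0 by auto
      then show "c v *\<^sub>R E (s -` {v}) x = min (c v) K *\<^sub>R E (s -` {v}) x" by simp
    qed
    have le: "norm (?S c) \<le> K * projection_bound * norm x"
      if "\<And>v. 0 \<le> c v" "\<And>v. c v \<le> cmod v \<or> c v \<le> 0" for c
      by (subst trunc[OF that(2)], rule norm_weighted_projections_le[OF s]) (use that(1) K0 in auto)
    show ?thesis
      by (intro add_mono le)
        (auto simp: max_def intro: complex_Re_le_cmod abs_Im_le_cmod order_trans[OF abs_ge_minus_self abs_Re_le_cmod]
          order_trans[OF abs_ge_minus_self abs_Im_le_cmod] order_trans[OF abs_ge_self abs_Im_le_cmod])
  qed
  finally show ?thesis by (simp add: mult_ac)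
qed

end

section \<open>Integrals of bounded Borel functions\<close>

definition bounded_borel :: "(complex \<Rightarrow> complex) \<Rightarrow> bool"
  where "bounded_borel F \<longleftrightarrow> F \<in> borel_measurable borel \<and> bounded (range F)"

lemma bounded_borelI:
  "F \<in> borel_measurable borel \<Longrightarrow> (\<And>z. cmod (F z) \<le> K) \<Longrightarrow> bounded_borel F"
  by (auto simp: bounded_borel_def bounded_iff)

lemma bounded_borel_measurable [measurable_dest]: "bounded_borel F \<Longrightarrow> F \<in> borel_measurable borel"
  by (simp add: bounded_borel_def)

lemma bounded_borelE:
  assumes "bounded_borel F" obtains K where "K > 0" "\<And>z. cmod (F z) \<le> K"
  using assms unfolding bounded_borel_def bounded_pos by auto

lemma bounded_borel_add:
  assumes "bounded_borel F" "bounded_borel G"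
  shows "bounded_borel (\<lambda>z. F z + G z)"
proof -
  obtain K where "\<And>z. cmod (F z) \<le> K" using assms(1) bounded_borelE by blast
  moreover obtain L where "\<And>z. cmod (G z) \<le> L" using assms(2) bounded_borelE by blast
  ultimately have "cmod (F z + G z) \<le> K + L" for z
    by (intro order_trans[OF norm_triangle_ineq] add_mono)
  then show ?thesis
    using assms by (intro bounded_borelI borel_measurable_add) (auto simp: bounded_borel_def)
qed

lemma bounded_borel_mult:
  assumes "bounded_borel F" "bounded_borel G"
  shows "bounded_borel (\<lambda>z. F z * G z)"
proof -
  obtain K where "K > 0" "\<And>z. cmod (F z) \<le> K" using assms(1) bounded_borelE by blast
  moreover obtain L where "\<And>z. cmod (G z) \<le> L" using assms(2) bounded_borelE by blast
  ultimately have "cmod (F z * G z) \<le> K * L" for z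
    unfolding norm_mult by (intro mult_mono) auto
  then show ?thesis
    using assms by (intro bounded_borelI borel_measurable_times) (auto simp: bounded_borel_def)
qed

lemma bounded_borel_const: "bounded_borel (\<lambda>z. c)"
  by (rule bounded_borelI[of _ "cmod c"]) auto

lemma bounded_borel_indicator: "\<delta> \<in> sets borel \<Longrightarrow> bounded_borel (indicator \<delta>)"
  by (rule bounded_borelI[of _ 1]) (auto simp: indicator_def)

lemma bounded_borel_diff:
  assumes "bounded_borel F" "bounded_borel G"
  shows "bounded_borel (\<lambda>z. F z - G z)"
  using bounded_borel_add[OF assms(1) bounded_borel_mult[OF bounded_borel_const[of "- 1"] assms(2)]]
  by simp

text \<open>Rounding the real and imaginary part down to multiples of \<open>1 / Suc n\<close>.\<close>

lemma simple_approximation: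
  assumes "bounded_borel F"
  shows "\<exists>s. (\<forall>n. simple_function borel (s n)) \<and> uniform_limit UNIV s F sequentially"
proof -
  have [measurable]: "F \<in> borel_measurable borel" using assms by (simp add: bounded_borel_def)
  obtain K where K: "K > 0" "\<And>z. cmod (F z) \<le> K" using assms bounded_borelE by blast
  define r where "r n x = real_of_int \<lfloor>real (Suc n) * x\<rfloor> / real (Suc n)" for n x
  have r: "\<bar>r n x - x\<bar> \<le> 1 / real (Suc n)" for n x
  proof -
    have "\<bar>real_of_int \<lfloor>real (Suc n) * x\<rfloor> - real (Suc n) * x\<bar> \<le> 1" by linarith
    moreover have "r n x - x = (real_of_int \<lfloor>real (Suc n) * x\<rfloor> - real (Suc n) * x) / real (Suc n)"
      by (simp add: r_def field_simps)
    ultimately show ?thesis by (simp add: divide_right_mono abs_divide del: of_nat_Suc)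
  qed
  have finite_r: "finite (r n ` {-K..K})" for n
  proof -
    let ?k = "\<lambda>x. \<lfloor>real (Suc n) * x\<rfloor>"
    have "?k (- K) \<le> ?k x \<and> ?k x \<le> ?k K" if "x \<in> {-K..K}" for x
      using that by (intro conjI floor_mono mult_left_mono) auto
    then have "r n ` {-K..K} \<subseteq> (\<lambda>k. real_of_int k / real (Suc n)) ` {?k (- K)..?k K}"
      unfolding r_def by (intro image_subsetI imageI) (simp only: atLeastAtMost_iff)
    then show ?thesis by (rule finite_subset) simp
  qed
  define s where "s n z = Complex (r n (Re (F z))) (r n (Im (F z)))" for n z
  have "simple_function borel (s n)" for n
  proof (rule simple_function_borel_measurable)
    have "s n = (\<lambda>z. complex_of_real (r n (Re (F z))) + \<i> * complex_of_real (r n (Im (F z))))"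
      by (auto simp: s_def complex_eq_iff)
    then show "s n \<in> borel_measurable borel" unfolding r_def by simp
    have K': "Re (F z) \<in> {-K..K}" "Im (F z) \<in> {-K..K}" for z
      using abs_Re_le_cmod[of "F z"] abs_Im_le_cmod[of "F z"] K(2)[of z]
      unfolding atLeastAtMost_iff by linarith+
    have "s n z = case_prod Complex (r n (Re (F z)), r n (Im (F z)))" for z
      by (simp add: s_def)
    then have "s n ` space borel \<subseteq> case_prod Complex ` (r n ` {-K..K} \<times> r n ` {-K..K})"
      by (intro image_subsetI) (simp only:, intro imageI SigmaI K')
    then show "finite (s n ` space borel)"
      by (rule finite_subset) (simp add: finite_r)
  qed
  moreover have "uniform_limit UNIV s F sequentially"
  proof (rule uniform_limitI)
    fix e :: real assume "e > 0"
    have "(\<lambda>n. 2 / real (Suc n)) \<longlonglongrightarrow> 0"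
      using LIMSEQ_inverse_real_of_nat tendsto_mult_right_zero[of _ sequentially 2]
      by (simp add: divide_inverse)
    then have "\<forall>\<^sub>F n in sequentially. 2 / real (Suc n) < e"
      using \<open>e > 0\<close> by (rule order_tendstoD)
    then show "\<forall>\<^sub>F n in sequentially. \<forall>z\<in>UNIV. dist (s n z) (F z) < e"
    proof (rule eventually_mono, intro ballI)
      fix n z assume n: "2 / real (Suc n) < e"
      have "dist (s n z) (F z) \<le> \<bar>Re (s n z - F z)\<bar> + \<bar>Im (s n z - F z)\<bar>"
        unfolding dist_norm by (rule cmod_le)
      also have "\<dots> \<le> 1 / real (Suc n) + 1 / real (Suc n)"
        using r[of n "Re (F z)"] r[of n "Im (F z)"] by (simp add: s_def)
      finally show "dist (s n z) (F z) < e" using n by simp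
    qed
  qed
  ultimately show ?thesis by blast
qed

context spectral_measure
begin

abbreviation \<Phi> :: "(complex \<Rightarrow> complex) \<Rightarrow> 'a \<Rightarrow> 'a"
  where "\<Phi> \<equiv> bounded_spectral_integral E"

abbreviation bound :: real
  where "bound \<equiv> 4 * projection_bound"

lemma bound_pos: "bound > 0"
  using projection_bound_pos by simp

lemma norm_simple_integral_diff_le:
  assumes "simple_function borel s" "simple_function borel t" "\<And>z. cmod (s z - t z) \<le> K"
  shows "norm (simple_spectral_integral E s x - simple_spectral_integral E t x) \<le> bound * K * norm x"
  using norm_simple_integral_le[OF simple_function_diff[OF assms(1,2)] assms(3), of x] assms(1,2)
  by (simp add: simple_integral_diff)

text \<open>With \<open>t = s\<close> this is the Cauchy property; in general it makes the limit independent of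
  the approximating sequence.\<close>

lemma simple_integral_limits_agree:
  assumes s: "\<And>n. simple_function borel (s n)" "uniform_limit UNIV s F sequentially"
    and t: "\<And>n. simple_function borel (t n)" "uniform_limit UNIV t F sequentially"
    and "\<epsilon> > 0"
  shows "\<exists>N. \<forall>m\<ge>N. \<forall>n\<ge>N.
    norm (simple_spectral_integral E (s m) x - simple_spectral_integral E (t n) x) < \<epsilon>"
proof -
  define e where "e = \<epsilon> / (2 * (bound * (norm x + 1)))"
  have "bound * (norm x + 1) > 0" using bound_pos by (intro mult_pos_pos add_nonneg_pos) auto
  then have e: "e > 0" "2 * (bound * (norm x + 1)) * e = \<epsilon>"
    using \<open>\<epsilon> > 0\<close> by (auto simp: e_def)
  obtain N where N: "\<And>n z. n \<ge> N \<Longrightarrow> dist (s n z) (F z) < e \<and> dist (t n z) (F z) < e"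
    using eventually_conj[OF uniform_limitD[OF s(2) e(1)] uniform_limitD[OF t(2) e(1)]]
    by (auto simp: eventually_sequentially)
  show ?thesis
  proof (intro exI allI impI)
    fix m n assume "m \<ge> N" "n \<ge> N"
    have "cmod (s m z - t n z) \<le> 2 * e" for z
      using N[OF \<open>m \<ge> N\<close>, of z] N[OF \<open>n \<ge> N\<close>, of z] dist_triangle2[of "s m z" "t n z" "F z"]
      by (simp add: dist_norm)
    then have "norm (simple_spectral_integral E (s m) x - simple_spectral_integral E (t n) x)
        \<le> bound * (2 * e) * norm x"
      by (intro norm_simple_integral_diff_le s t)
    also have "\<dots> < bound * (2 * e) * (norm x + 1)"
      using bound_pos e(1) by (intro mult_strict_left_mono) auto
    also have "\<dots> = \<epsilon>" unfolding e(2)[symmetric] by (simp add: mult_ac)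
    finally show "norm (simple_spectral_integral E (s m) x - simple_spectral_integral E (t n) x) < \<epsilon>" .
  qed
qed

lemma simple_integral_tendsto:
  assumes s: "\<And>n. simple_function borel (s n)" "uniform_limit UNIV s F sequentially"
  shows "(\<lambda>n. simple_spectral_integral E (s n) x) \<longlonglongrightarrow> \<Phi> F x"
proof -
  have "Cauchy (\<lambda>n. simple_spectral_integral E (s n) x)"
    using simple_integral_limits_agree[OF s s] by (intro CauchyI) blast
  then obtain y where y: "(\<lambda>n. simple_spectral_integral E (s n) x) \<longlonglongrightarrow> y"
    using Cauchy_convergent_iff convergent_def by blast
  have "\<Phi> F x = y"
    unfolding bounded_spectral_integral_def
  proof (rule the_equality)
    show "\<exists>s. (\<forall>n. simple_function borel (s n)) \<and> uniform_limit UNIV s F sequentially \<and>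
        (\<lambda>n. simple_spectral_integral E (s n) x) \<longlonglongrightarrow> y"
      using s y by blast
    fix y' assume "\<exists>t. (\<forall>n. simple_function borel (t n)) \<and> uniform_limit UNIV t F sequentially \<and>
        (\<lambda>n. simple_spectral_integral E (t n) x) \<longlonglongrightarrow> y'"
    then obtain t where t: "\<And>n. simple_function borel (t n)" "uniform_limit UNIV t F sequentially"
      and y': "(\<lambda>n. simple_spectral_integral E (t n) x) \<longlonglongrightarrow> y'" by blast
    have "(\<lambda>n. simple_spectral_integral E (t n) x - simple_spectral_integral E (s n) x) \<longlonglongrightarrow> 0"
      using simple_integral_limits_agree[OF t s] by (intro LIMSEQ_I) (simp, blast)
    with tendsto_diff[OF y' y] show "y' = y"
      using LIMSEQ_unique by fastforce
  qed
  with y show ?thesis by simp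
qed

lemma \<Phi>_approximation:
  assumes "bounded_borel F"
  obtains s where "\<And>n. simple_function borel (s n)" "uniform_limit UNIV s F sequentially"
    "\<And>x. (\<lambda>n. simple_spectral_integral E (s n) x) \<longlonglongrightarrow> \<Phi> F x"
  using simple_approximation[OF assms] simple_integral_tendsto by metis

lemma \<Phi>_indicator:
  assumes "\<delta> \<in> sets borel"
  shows "\<Phi> (indicator \<delta>) x = E \<delta> x"
proof -
  have "(\<lambda>n::nat. simple_spectral_integral E (indicator \<delta>) x) \<longlonglongrightarrow> \<Phi> (indicator \<delta>) x"
    using assms by (intro simple_integral_tendsto) (auto intro: uniform_limit_const)
  from LIMSEQ_unique[OF this tendsto_const] show ?thesis
    using assms by (simp add: simple_integral_indicator)
qed

lemma \<Phi>_add: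
  assumes F: "bounded_borel F" and G: "bounded_borel G"
  shows "\<Phi> (\<lambda>z. F z + G z) x = \<Phi> F x + \<Phi> G x"
proof -
  obtain s where s: "\<And>n. simple_function borel (s n)" "uniform_limit UNIV s F sequentially"
    "\<And>x. (\<lambda>n. simple_spectral_integral E (s n) x) \<longlonglongrightarrow> \<Phi> F x"
    using \<Phi>_approximation[OF F] by blast
  obtain t where t: "\<And>n. simple_function borel (t n)" "uniform_limit UNIV t G sequentially"
    "\<And>x. (\<lambda>n. simple_spectral_integral E (t n) x) \<longlonglongrightarrow> \<Phi> G x"
    using \<Phi>_approximation[OF G] by blast
  have "(\<lambda>n. simple_spectral_integral E (\<lambda>z. s n z + t n z) x) \<longlonglongrightarrow> \<Phi> (\<lambda>z. F z + G z) x"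
    by (intro simple_integral_tendsto simple_function_add s t uniform_limit_add)
  moreover have "(\<lambda>n. simple_spectral_integral E (\<lambda>z. s n z + t n z) x) \<longlonglongrightarrow> \<Phi> F x + \<Phi> G x"
    unfolding simple_integral_add[OF s(1) t(1)] by (intro tendsto_add s t)
  ultimately show ?thesis by (rule LIMSEQ_unique)
qed

lemma norm_\<Phi>_le:
  assumes "F \<in> borel_measurable borel" and K: "\<And>z. cmod (F z) \<le> K"
  shows "norm (\<Phi> F x) \<le> bound * K * norm x"
proof -
  have "bounded_borel F" using assms by (rule bounded_borelI)
  then obtain s where s: "\<And>n. simple_function borel (s n)" "uniform_limit UNIV s F sequentially"
    "\<And>x. (\<lambda>n. simple_spectral_integral E (s n) x) \<longlonglongrightarrow> \<Phi> F x"
    using \<Phi>_approximation by blast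
  have le: "norm (\<Phi> F x) \<le> bound * (K + e) * norm x" if "e > 0" for e
  proof (rule tendsto_upperbound[OF tendsto_norm[OF s(3)]])
    show "\<forall>\<^sub>F n in sequentially. norm (simple_spectral_integral E (s n) x) \<le> bound * (K + e) * norm x"
      using uniform_limitD[OF s(2) that]
    proof (rule eventually_mono)
      fix n assume n: "\<forall>z\<in>UNIV. dist (s n z) (F z) < e"
      have "cmod (s n z) \<le> K + e" for z
      proof -
        have "cmod (s n z - F z) < e" using n by (simp add: dist_norm)
        then show ?thesis using K[of z] norm_triangle_sub[of "s n z" "F z"] by linarith
      qed
      then show "norm (simple_spectral_integral E (s n) x) \<le> bound * (K + e) * norm x"
        by (intro norm_simple_integral_le s)
    qed
  qed simp
  have "((\<lambda>e. bound * (K + e) * norm x) \<longlongrightarrow> bound * (K + 0) * norm x) (at_right 0)"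
    by (intro tendsto_intros)
  then have "norm (\<Phi> F x) \<le> bound * (K + 0) * norm x"
  proof (rule tendsto_lowerbound)
    show "\<forall>\<^sub>F e in at_right 0. norm (\<Phi> F x) \<le> bound * (K + e) * norm x"
      using eventually_at_right_less[of "0::real"] by (rule eventually_mono) (rule le)
  qed simp
  then show ?thesis by simp
qed

lemma \<Phi>_mult:
  assumes F: "bounded_borel F" and G: "bounded_borel G"
  shows "\<Phi> (\<lambda>z. F z * G z) x = \<Phi> F (\<Phi> G x)"
proof -
  obtain s where s: "\<And>n. simple_function borel (s n)" "uniform_limit UNIV s F sequentially"
    "\<And>x. (\<lambda>n. simple_spectral_integral E (s n) x) \<longlonglongrightarrow> \<Phi> F x"
    using \<Phi>_approximation[OF F] by blast
  obtain t where t: "\<And>n. simple_function borel (t n)" "uniform_limit UNIV t G sequentially"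
    "\<And>x. (\<lambda>n. simple_spectral_integral E (t n) x) \<longlonglongrightarrow> \<Phi> G x"
    using \<Phi>_approximation[OF G] by blast
  obtain K where K: "K > 0" "\<And>z. cmod (F z) \<le> K" using F bounded_borelE by blast
  have "uniform_limit UNIV (\<lambda>n z. s n z * t n z) (\<lambda>z. F z * G z) sequentially"
    using F G s(2) t(2) by (intro uniform_lim_mult) (auto simp: bounded_borel_def)
  then have "(\<lambda>n. simple_spectral_integral E (\<lambda>z. s n z * t n z) x) \<longlonglongrightarrow> \<Phi> (\<lambda>z. F z * G z) x"
    by (intro simple_integral_tendsto simple_function_mult s t)
  moreover have "(\<lambda>n. simple_spectral_integral E (s n) (simple_spectral_integral E (t n) x)) \<longlonglongrightarrow> \<Phi> F (\<Phi> G x)"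
  proof -
    let ?I = "simple_spectral_integral E"
    have "(\<lambda>n. ?I (s n) (?I (t n) x - \<Phi> G x)) \<longlonglongrightarrow> 0"
    proof (rule Lim_null_comparison)
      show "\<forall>\<^sub>F n in sequentially. norm (?I (s n) (?I (t n) x - \<Phi> G x))
          \<le> bound * (K + 1) * norm (?I (t n) x - \<Phi> G x)"
        using uniform_limitD[OF s(2) zero_less_one]
      proof (rule eventually_mono)
        fix n assume n: "\<forall>z\<in>UNIV. dist (s n z) (F z) < 1"
        have "cmod (s n z) \<le> K + 1" for z
        proof -
          have "cmod (s n z - F z) < 1" using n by (simp add: dist_norm)
          then show ?thesis using K(2)[of z] norm_triangle_sub[of "s n z" "F z"] by linarith
        qed
        then show "norm (?I (s n) (?I (t n) x - \<Phi> G x)) \<le> bound * (K + 1) * norm (?I (t n) x - \<Phi> G x)"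
          by (intro norm_simple_integral_le s)
      qed
      have "(\<lambda>n. ?I (t n) x - \<Phi> G x) \<longlonglongrightarrow> 0" using t(3) LIM_zero by blast
      then show "(\<lambda>n. bound * (K + 1) * norm (?I (t n) x - \<Phi> G x)) \<longlonglongrightarrow> 0"
        by (intro tendsto_mult_right_zero tendsto_norm_zero)
    qed
    from tendsto_add[OF this s(3)[of "\<Phi> G x"]] show ?thesis
      by (simp flip: simple_integral_linear(1)[OF s(1)])
  qed
  ultimately show ?thesis
    unfolding simple_integral_mult[OF s(1) t(1)] by (rule LIMSEQ_unique)
qed

lemma bounded_clinear_\<Phi>:
  assumes F: "bounded_borel F"
  shows "bounded_clinear (\<Phi> F)"
proof -
  obtain s where s: "\<And>n. simple_function borel (s n)" "uniform_limit UNIV s F sequentially"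
    "\<And>x. (\<lambda>n. simple_spectral_integral E (s n) x) \<longlonglongrightarrow> \<Phi> F x"
    using \<Phi>_approximation[OF F] by blast
  obtain K where K: "\<And>z. cmod (F z) \<le> K" using F bounded_borelE by blast
  show ?thesis
  proof (rule bounded_clinearI)
    show "\<Phi> F (x + y) = \<Phi> F x + \<Phi> F y" for x y
      using s(3)[of "x + y"] tendsto_add[OF s(3)[of x] s(3)[of y]]
      unfolding simple_integral_linear(1)[OF s(1)] by (rule LIMSEQ_unique)
    show "\<Phi> F (c *\<^sub>C x) = c *\<^sub>C \<Phi> F x" for c x
      using s(3)[of "c *\<^sub>C x"] scaleC.tendsto[OF tendsto_const s(3)[of x]]
      unfolding simple_integral_linear(2)[OF s(1)] by (rule LIMSEQ_unique)
    show "norm (\<Phi> F x) \<le> bound * K * norm x" for x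
      by (rule norm_\<Phi>_le[OF bounded_borel_measurable[OF F] K])
  qed
qed

lemma bounded_linear_\<Phi>: "bounded_borel F \<Longrightarrow> bounded_linear (\<Phi> F)"
  using bounded_clinear_\<Phi> by (simp add: bounded_clinear_def)

lemma \<Phi>_const_mult:
  assumes "bounded_borel F"
  shows "\<Phi> (\<lambda>z. c * F z) x = c *\<^sub>C \<Phi> F x"
proof -
  obtain s where s: "\<And>n. simple_function borel (s n)" "uniform_limit UNIV s F sequentially"
    "\<And>x. (\<lambda>n. simple_spectral_integral E (s n) x) \<longlonglongrightarrow> \<Phi> F x"
    using \<Phi>_approximation[OF assms] by blast
  have "uniform_limit UNIV (\<lambda>n z. c * s n z) (\<lambda>z. c * F z) sequentially"
    using bounded_linear.uniform_limit[OF bounded_linear_mult_right s(2)] .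
  then have "(\<lambda>n. simple_spectral_integral E (\<lambda>z. c * s n z) x) \<longlonglongrightarrow> \<Phi> (\<lambda>z. c * F z) x"
    by (intro simple_integral_tendsto simple_function_mult simple_function_const s)
  moreover have "(\<lambda>n. simple_spectral_integral E (\<lambda>z. c * s n z) x) \<longlonglongrightarrow> c *\<^sub>C \<Phi> F x"
    unfolding simple_integral_scale[OF s(1)] by (intro scaleC.tendsto tendsto_const s)
  ultimately show ?thesis by (rule LIMSEQ_unique)
qed

lemma \<Phi>_diff:
  assumes "bounded_borel F" "bounded_borel G"
  shows "\<Phi> (\<lambda>z. F z - G z) x = \<Phi> F x - \<Phi> G x"
  using \<Phi>_add[OF assms(1) bounded_borel_mult[OF bounded_borel_const[of "- 1"] assms(2)], of x]
    \<Phi>_const_mult[OF assms(2), of "- 1" x]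
  by (simp add: scaleC.minus_left)

lemma \<Phi>_commute:
  assumes "bounded_borel F" "bounded_borel G"
  shows "\<Phi> F (\<Phi> G x) = \<Phi> G (\<Phi> F x)"
  using \<Phi>_mult[OF assms, of x] \<Phi>_mult[OF assms(2,1), of x] by (simp add: mult.commute)

lemma \<Phi>_mult_indicator:
  assumes "bounded_borel F" "\<delta> \<in> sets borel"
  shows "\<Phi> (\<lambda>z. F z * indicator \<delta> z) x = \<Phi> F (E \<delta> x)"
    and "\<Phi> F (E \<delta> x) = E \<delta> (\<Phi> F x)"
  using \<Phi>_mult[OF assms(1) bounded_borel_indicator[OF assms(2)], of x]
    \<Phi>_commute[OF assms(1) bounded_borel_indicator[OF assms(2)], of x]
  by (simp_all add: \<Phi>_indicator[OF assms(2)])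

text \<open>Let \<open>\<delta> n\<close> be the set where some \<open>F m\<close> with \<open>m \<ge> n\<close> still differs from \<open>G\<close> by more than \<open>\<epsilon>\<close>. These sets
  decrease to the empty set, so \<open>E (\<delta> n) x\<close> tends to \<open>0\<close>. Multiplicativity shows that the part of the
  integral over \<open>\<delta> n\<close> factors through \<open>E (\<delta> n) x\<close>, and off \<open>\<delta> n\<close> the integrand is small.\<close>

lemma \<Phi>_dominated_convergence:
  assumes F: "\<And>n. F n \<in> borel_measurable borel" "\<And>n z. cmod (F n z) \<le> K"
    and lim: "\<And>z. (\<lambda>n. F n z) \<longlonglongrightarrow> G z"
  shows "(\<lambda>n. \<Phi> (F n) x) \<longlonglongrightarrow> \<Phi> G x"
proof -
  have [measurable]: "F n \<in> borel_measurable borel" for n by (rule F)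
  have G [measurable]: "G \<in> borel_measurable borel"
    by (rule borel_measurable_LIMSEQ_metric[OF F(1)]) (rule lim)
  have GK: "cmod (G z) \<le> K" for z
    by (rule tendsto_upperbound[OF tendsto_norm[OF lim]]) (auto simp: F)
  have K: "0 \<le> K" using GK[of 0] norm_ge_zero order_trans by blast
  have bF: "bounded_borel (F n)" for n using F by (rule bounded_borelI)
  have bG: "bounded_borel G" using G GK by (rule bounded_borelI)
  have diff: "\<Phi> (F n) x - \<Phi> G x = \<Phi> (\<lambda>z. F n z - G z) x" for n
    by (simp add: \<Phi>_diff bF bG)
  have "(\<lambda>n. \<Phi> (\<lambda>z. F n z - G z) x) \<longlonglongrightarrow> 0"
  proof (rule LIMSEQ_I)
    fix r :: real assume "r > 0"
    define \<epsilon> where "\<epsilon> = r / (2 * (bound * (norm x + 1)))"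
    have pos: "bound * (norm x + 1) > 0" using bound_pos by (intro mult_pos_pos add_nonneg_pos) auto
    then have \<epsilon>: "\<epsilon> > 0" "2 * (bound * (norm x + 1)) * \<epsilon> = r"
      using \<open>r > 0\<close> by (auto simp: \<epsilon>_def)
    define \<delta> where "\<delta> n = (\<Union>m\<in>{n..}. {z. \<epsilon> < cmod (F m z - G z)})" for n
    have \<delta> [measurable]: "\<delta> n \<in> sets borel" for n unfolding \<delta>_def by measurable
    have "(\<Inter>n. \<delta> n) = {}"
    proof -
      have "\<exists>n. z \<notin> \<delta> n" for z
        using LIMSEQ_D[OF lim \<epsilon>(1), of z] by (force simp: \<delta>_def)
      then show ?thesis by blast
    qed
    moreover have "antimono \<delta>" by (force simp: \<delta>_def antimono_def)
    ultimately have "(\<lambda>n. bound * (2 * K) * norm (E (\<delta> n) x)) \<longlonglongrightarrow> 0"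
      by (intro tendsto_mult_right_zero tendsto_norm_zero E_decreasing_empty \<delta>)
    then have "\<forall>\<^sub>F n in sequentially. bound * (2 * K) * norm (E (\<delta> n) x) < r / 2"
      using \<open>r > 0\<close> by (intro order_tendstoD) auto
    then obtain N where N: "\<And>n. n \<ge> N \<Longrightarrow> bound * (2 * K) * norm (E (\<delta> n) x) < r / 2"
      unfolding eventually_sequentially by blast
    have "norm (\<Phi> (\<lambda>z. F n z - G z) x - 0) < r" if "n \<ge> N" for n
    proof -
      let ?H = "\<lambda>z. F n z - G z"
      have H: "bounded_borel ?H" by (intro bounded_borel_diff bF bG)
      have HK: "cmod (?H z) \<le> 2 * K" for z
        using norm_triangle_ineq4[of "F n z" "G z"] F(2)[of n z] GK[of z] by linarith
      have "\<Phi> ?H x = \<Phi> (\<lambda>z. ?H z * indicator (\<delta> n) z + ?H z * indicator (- \<delta> n) z) x"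
        by (rule arg_cong[where f = "\<lambda>F. \<Phi> F x"]) (auto simp: indicator_def)
      also have "\<dots> = \<Phi> (\<lambda>z. ?H z * indicator (\<delta> n) z) x + \<Phi> (\<lambda>z. ?H z * indicator (- \<delta> n) z) x"
        by (intro \<Phi>_add bounded_borel_mult H bounded_borel_indicator) auto
      also have "norm \<dots> \<le> bound * (2 * K) * norm (E (\<delta> n) x) + bound * \<epsilon> * norm x"
      proof (intro order_trans[OF norm_triangle_ineq] add_mono)
        show "norm (\<Phi> (\<lambda>z. ?H z * indicator (\<delta> n) z) x) \<le> bound * (2 * K) * norm (E (\<delta> n) x)"
          unfolding \<Phi>_mult_indicator(1)[OF H \<delta>] by (rule norm_\<Phi>_le) (use HK in auto)
        have "cmod (?H z * indicator (- \<delta> n) z) \<le> \<epsilon>" for z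
          using \<epsilon>(1) by (auto simp: \<delta>_def indicator_def not_less)
        then show "norm (\<Phi> (\<lambda>z. ?H z * indicator (- \<delta> n) z) x) \<le> bound * \<epsilon> * norm x"
          by (intro norm_\<Phi>_le) auto
      qed
      also have "bound * \<epsilon> * norm x \<le> r / 2"
      proof -
        have "bound * \<epsilon> * norm x \<le> bound * \<epsilon> * (norm x + 1)"
          using bound_pos \<epsilon>(1) by (intro mult_left_mono) auto
        also have "\<dots> = r / 2"
          unfolding \<epsilon>(2)[symmetric] by simp
        finally show ?thesis .
      qed
      finally show ?thesis using N[OF that] by simp
    qed
    then show "\<exists>N. \<forall>n\<ge>N. norm (\<Phi> (\<lambda>z. F n z - G z) x - 0) < r" by blast
  qed
  then show ?thesis unfolding diff[symmetric] by (rule LIM_zero_cancel)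
qed

end

section \<open>Scalar type spectral operators\<close>

locale scalar_type_operator =
  densely_defined_closed_operator D A + spectral_measure E
  for D :: "'a::complex_banach set" and A and E :: "complex set \<Rightarrow> 'a \<Rightarrow> 'a" +
  assumes E_spectrum: "E (spectrum D A) = id"
    and domain: "D = spectral_integral_domain E (spectrum D A) (\<lambda>z. z)"
    and operator: "x \<in> D \<Longrightarrow> A x = spectral_integral E (spectrum D A) (\<lambda>z. z) x"
begin

abbreviation \<sigma> :: "complex set"
  where "\<sigma> \<equiv> spectrum D A"

definition part :: "nat \<Rightarrow> complex set"
  where "part n = {z \<in> \<sigma>. cmod z \<le> real n}"

definition T :: "nat \<Rightarrow> 'a \<Rightarrow> 'a"
  where "T n = \<Phi> (\<lambda>z. z * indicator (part n) z)"

lemma spectrum_borel [measurable]: "\<sigma> \<in> sets borel"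
  using closed_spectrum by (rule borel_closed)

lemma part_borel [measurable]: "part n \<in> sets borel"
  unfolding part_def by measurable

lemma E_part_tendsto: "(\<lambda>n. E (part n) x) \<longlonglongrightarrow> x"
proof -
  have "(\<Union>n. part n) = \<sigma>"
    using real_arch_simple by (auto simp: part_def)
  moreover have "(\<lambda>n. E (part n) x) \<longlonglongrightarrow> E (\<Union>n. part n) x"
    by (intro E_increasing) (auto simp: part_def mono_def)
  ultimately show ?thesis by (simp add: E_spectrum)
qed

lemma truncation_eq: "bounded_spectral_integral E (truncation \<sigma> (\<lambda>z. z) n) = T n"
  by (simp add: T_def truncation_def[abs_def] part_def)

lemma bounded_borel_T: "bounded_borel (\<lambda>z. z * indicator (part n) z)"
  by (rule bounded_borelI[of _ "real n"]) (auto simp: part_def indicator_def)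

lemma T_tendsto: "x \<in> D \<Longrightarrow> (\<lambda>n. T n x) \<longlonglongrightarrow> A x"
  using domain operator
  by (auto simp: spectral_integral_domain_def spectral_integral_def truncation_eq convergent_LIMSEQ_iff)

lemma domainI:
  assumes "(\<lambda>n. T n x) \<longlonglongrightarrow> y"
  shows "x \<in> D" "A x = y"
proof -
  show "x \<in> D"
    using assms by (subst domain) (auto simp: spectral_integral_domain_def truncation_eq convergent_def)
  then show "A x = y" using T_tendsto assms LIMSEQ_unique by blast
qed

text \<open>With \<open>H\<close> equal to \<open>z * G\<close> on the spectrum, both compositions of \<open>\<Phi> G\<close> with the truncation \<open>T n\<close> of \<open>A\<close>
  integrate \<open>H\<close> over a bounded part of the spectrum, where all functions are bounded.\<close>

lemma \<Phi>_T:
  assumes G: "bounded_borel G" and H: "bounded_borel H" and H_eq: "\<And>z. z \<in> \<sigma> \<Longrightarrow> H z = z * G z"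
  shows "\<Phi> G (T n x) = \<Phi> H (E (part n) x)" and "T n (\<Phi> G x) = \<Phi> H (E (part n) x)"
proof -
  have "(\<lambda>z. G z * (z * indicator (part n) z)) = (\<lambda>z. H z * indicator (part n) z)"
    using H_eq by (auto simp: part_def indicator_def)
  then show "\<Phi> G (T n x) = \<Phi> H (E (part n) x)"
    unfolding T_def using \<Phi>_mult[OF G bounded_borel_T] \<Phi>_mult_indicator(1)[OF H part_borel] by metis
  then show "T n (\<Phi> G x) = \<Phi> H (E (part n) x)"
    unfolding T_def using \<Phi>_commute[OF G bounded_borel_T] by metis
qed

lemma \<Phi>_A:
  assumes GH: "bounded_borel G" "bounded_borel H" "\<And>z. z \<in> \<sigma> \<Longrightarrow> H z = z * G z" and "x \<in> D"
  shows "\<Phi> G (A x) = \<Phi> H x"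
proof -
  have "(\<lambda>n. \<Phi> G (T n x)) \<longlonglongrightarrow> \<Phi> G (A x)"
    by (rule bounded_linear.tendsto[OF bounded_linear_\<Phi>[OF GH(1)] T_tendsto[OF \<open>x \<in> D\<close>]])
  moreover have "(\<lambda>n. \<Phi> G (T n x)) \<longlonglongrightarrow> \<Phi> H x"
    by (subst \<Phi>_T(1)[OF GH], assumption) (rule bounded_linear.tendsto[OF bounded_linear_\<Phi>[OF GH(2)] E_part_tendsto])
  ultimately show ?thesis by (rule LIMSEQ_unique)
qed

lemma A_\<Phi>:
  assumes GH: "bounded_borel G" "bounded_borel H" "\<And>z. z \<in> \<sigma> \<Longrightarrow> H z = z * G z"
  shows "\<Phi> G x \<in> D" "A (\<Phi> G x) = \<Phi> H x"
proof -
  have "(\<lambda>n. T n (\<Phi> G x)) \<longlonglongrightarrow> \<Phi> H x"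
    by (subst \<Phi>_T(2)[OF GH], assumption) (rule bounded_linear.tendsto[OF bounded_linear_\<Phi>[OF GH(2)] E_part_tendsto])
  then show "\<Phi> G x \<in> D" "A (\<Phi> G x) = \<Phi> H x" by (rule domainI)+
qed

text \<open>If \<open>E\<close> vanished on a disc around \<open>w\<close>, then \<open>1 / (z - w)\<close>, cut off on the disc, would be
  bounded, and its integral would be the inverse of \<open>A - w\<close>.\<close>

lemma spectrum_support:
  assumes "w \<in> \<sigma>" "r > 0"
  shows "\<exists>y. y \<noteq> 0 \<and> E (ball w r) y = y"
proof (rule ccontr)
  assume "\<not> ?thesis"
  moreover have "E (ball w r) (E (ball w r) x) = E (ball w r) x" for x
    by (simp add: E_Int)
  ultimately have null: "E (ball w r) x = 0" for x by blast
  let ?I = "\<lambda>z. indicator (- ball w r) z :: complex"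
  define G where "G z = ?I z / (z - w)" for z
  have I: "bounded_borel ?I" by (intro bounded_borel_indicator) simp
  have G: "bounded_borel G"
  proof (rule bounded_borelI)
    show "G \<in> borel_measurable borel" unfolding G_def by simp
    show "cmod (G z) \<le> 1 / r" for z
    proof (cases "z \<in> ball w r")
      case False
      then have "r \<le> cmod (z - w)" by (simp add: dist_norm norm_minus_commute)
      then show ?thesis using False \<open>r > 0\<close> by (simp add: G_def norm_divide frac_le)
    qed (use \<open>r > 0\<close> in \<open>simp add: G_def\<close>)
  qed
  define H where "H z = w * G z + ?I z" for z
  have H: "bounded_borel H"
    unfolding H_def by (intro bounded_borel_add bounded_borel_mult bounded_borel_const G I)
  have HG: "H z = z * G z" for z
    using \<open>r > 0\<close> by (cases "z = w") (simp_all add: H_def G_def field_simps)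
  have \<Phi>H: "\<Phi> H x = w *\<^sub>C \<Phi> G x + x" for x
  proof -
    have "\<Phi> H x = \<Phi> (\<lambda>z. w * G z) x + \<Phi> ?I x"
      unfolding H_def by (intro \<Phi>_add bounded_borel_mult bounded_borel_const G I)
    also have "\<Phi> ?I x = x"
      by (subst \<Phi>_indicator) (simp_all add: compl null)
    finally show ?thesis by (simp add: \<Phi>_const_mult G)
  qed
  have "w \<in> resolvent_set D A"
  proof (rule resolvent_setI[OF bounded_clinear_\<Phi>[OF G]])
    show "\<Phi> G y \<in> D \<and> A (\<Phi> G y) - w *\<^sub>C \<Phi> G y = y" for y
      using A_\<Phi>[OF G H HG, of y] by (simp add: \<Phi>H)
    show "\<Phi> G (A x - w *\<^sub>C x) = x" if "x \<in> D" for x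
    proof -
      have "\<Phi> G (w *\<^sub>C x) = w *\<^sub>C \<Phi> G x"
        using bounded_clinear_\<Phi>[OF G] by (simp add: bounded_clinear_def)
      then show ?thesis
        using \<Phi>_A[OF G H HG that] linear_diff[OF bounded_linear.linear[OF bounded_linear_\<Phi>[OF G]]]
        by (simp add: \<Phi>H)
    qed
  qed
  with \<open>w \<in> \<sigma>\<close> show False by (simp add: spectrum_def)
qed

text \<open>On the range of the projection of a small disc around \<open>w\<close>, the operator \<open>\<Phi> F\<close> is close to the scalar
  \<open>F w\<close>. Since that range is nonzero, a bound for the operators bounds the scalar. Localising to
  bounded sets admits unbounded \<open>F\<close>.\<close>

lemma cmod_le_of_norm_\<Phi>_le:
  assumes F: "continuous_on UNIV F" and "w \<in> \<sigma>"
    and B: "\<And>\<delta> x. \<delta> \<in> sets borel \<Longrightarrow> bounded \<delta> \<Longrightarrow> norm (\<Phi> (\<lambda>z. F z * indicator \<delta> z) x) \<le> B * norm x"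
  shows "cmod (F w) \<le> B"
proof (rule field_le_epsilon)
  fix e :: real assume "e > 0"
  define d where "d = e / bound"
  have d: "d > 0" "bound * d = e" using \<open>e > 0\<close> bound_pos by (auto simp: d_def)
  have [measurable]: "F \<in> borel_measurable borel" using F by (rule borel_measurable_continuous_onI)
  obtain r where r: "r > 0" "\<And>z. dist z w < r \<Longrightarrow> dist (F z) (F w) < d"
    using F d(1) unfolding continuous_on_iff by (metis UNIV_I)
  obtain y where y: "y \<noteq> 0" "E (ball w r) y = y" using spectrum_support[OF \<open>w \<in> \<sigma>\<close> r(1)] by blast
  let ?I = "\<lambda>z. indicator (ball w r) z :: complex"
  let ?H = "\<lambda>z. (F z - F w) * ?I z"
  have H: "cmod (?H z) \<le> d" for z
    using r(2)[of z] d(1) by (auto simp: indicator_def dist_norm norm_minus_commute less_imp_le)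
  have bI: "bounded_borel ?I" by (rule bounded_borel_indicator) simp
  have [measurable]: "?I \<in> borel_measurable borel" by (rule bounded_borel_measurable[OF bI])
  have bH: "bounded_borel ?H" by (rule bounded_borelI[OF _ H]) measurable
  have "\<Phi> (\<lambda>z. F z * ?I z) y = \<Phi> (\<lambda>z. ?H z + F w * ?I z) y"
    by (rule arg_cong[where f = "\<lambda>F. \<Phi> F y"]) (auto simp: algebra_simps)
  also have "\<dots> = \<Phi> ?H y + F w *\<^sub>C y"
    using \<Phi>_add[OF bH bounded_borel_mult[OF bounded_borel_const[of "F w"] bI], of y] y(2)
    by (simp add: \<Phi>_const_mult[OF bI] \<Phi>_indicator)
  finally have "F w *\<^sub>C y = \<Phi> (\<lambda>z. F z * ?I z) y - \<Phi> ?H y" by simp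
  then have "cmod (F w) * norm y = norm (\<Phi> (\<lambda>z. F z * ?I z) y - \<Phi> ?H y)"
    by (simp only: norm_scaleC[symmetric])
  also have "\<dots> \<le> norm (\<Phi> (\<lambda>z. F z * ?I z) y) + norm (\<Phi> ?H y)"
    by (rule norm_triangle_ineq4)
  also have "\<dots> \<le> B * norm y + e * norm y"
    using norm_\<Phi>_le[OF bounded_borel_measurable[OF bH] H, of y, unfolded d(2)] B[of "ball w r" y]
    by simp
  finally show "cmod (F w) \<le> B + e"
    using y(1) by (simp flip: distrib_right)
qed

end

section \<open>Exponential families\<close>

definition exp_monomial :: "complex set \<Rightarrow> nat \<Rightarrow> real \<Rightarrow> complex \<Rightarrow> complex"
  where "exp_monomial \<delta> n t z = z ^ n * exp (of_real t * z) * indicator \<delta> z"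

lemma cmod_exp_monomial: "cmod (exp_monomial \<delta> n t z) = cmod z ^ n * exp (t * Re z) * indicator \<delta> z"
  by (simp add: exp_monomial_def norm_mult norm_power indicator_def)

lemma exp_monomial_borel [measurable]:
  assumes [measurable]: "\<delta> \<in> sets borel"
  shows "exp_monomial \<delta> n t \<in> borel_measurable borel"
  unfolding exp_monomial_def[abs_def] by measurable

text \<open>The uniform bounds, near time \<open>t\<close>, that justify differentiating \<open>\<integral> z ^ n * exp (t z) dE\<close> under the
  integral to any order.\<close>

definition exp_dominated :: "complex set \<Rightarrow> real \<Rightarrow> real \<Rightarrow> bool"
  where "exp_dominated \<delta> t r \<longleftrightarrow>
    (\<forall>n. \<exists>K. \<forall>z\<in>\<delta>. \<forall>s. \<bar>s - t\<bar> \<le> r \<longrightarrow> cmod z ^ n * exp (s * Re z) \<le> K)"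

lemma exp_dominated_bounded:
  assumes "bounded \<delta>" shows "exp_dominated \<delta> t r"
  unfolding exp_dominated_def
proof
  fix n
  obtain R where R: "\<And>z. z \<in> \<delta> \<Longrightarrow> cmod z \<le> R"
    using assms unfolding bounded_iff by blast
  show "\<exists>K. \<forall>z\<in>\<delta>. \<forall>s. \<bar>s - t\<bar> \<le> r \<longrightarrow> cmod z ^ n * exp (s * Re z) \<le> K"
  proof (intro exI ballI allI impI)
    fix z s assume z: "z \<in> \<delta>" and s: "\<bar>s - t\<bar> \<le> r"
    have "s * Re z \<le> \<bar>s\<bar> * \<bar>Re z\<bar>" by (metis abs_ge_self abs_mult)
    also have "\<dots> \<le> (\<bar>t\<bar> + r) * R"
      using s R[OF z] abs_Re_le_cmod[of z] by (intro mult_mono) auto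
    finally show "cmod z ^ n * exp (s * Re z) \<le> R ^ n * exp ((\<bar>t\<bar> + r) * R)"
      using R[OF z] order_trans[OF norm_ge_zero R[OF z]]
      by (intro mult_mono power_mono) auto
  qed
qed

lemma exp_dominatedE:
  assumes "exp_dominated \<delta> t r"
  obtains K where "K \<ge> 0" "\<And>z s. z \<in> \<delta> \<Longrightarrow> \<bar>s - t\<bar> \<le> r \<Longrightarrow> cmod z ^ n * exp (s * Re z) \<le> K"
proof -
  obtain K where "\<forall>z\<in>\<delta>. \<forall>s. \<bar>s - t\<bar> \<le> r \<longrightarrow> cmod z ^ n * exp (s * Re z) \<le> K"
    using assms unfolding exp_dominated_def by blast
  then have "z \<in> \<delta> \<Longrightarrow> \<bar>s - t\<bar> \<le> r \<Longrightarrow> cmod z ^ n * exp (s * Re z) \<le> max K 0" for z s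
    by (meson max.coboundedI1)
  then show thesis using that[of "max K 0"] by simp
qed

lemma bounded_borel_exp_monomial:
  assumes "\<delta> \<in> sets borel" "exp_dominated \<delta> t r" "\<bar>s - t\<bar> \<le> r"
  shows "bounded_borel (exp_monomial \<delta> n s)"
proof -
  obtain K where "K \<ge> 0" "\<And>z s. z \<in> \<delta> \<Longrightarrow> \<bar>s - t\<bar> \<le> r \<Longrightarrow> cmod z ^ n * exp (s * Re z) \<le> K"
    using assms(2) exp_dominatedE by blast
  then show ?thesis
    using assms by (intro bounded_borelI[of _ K]) (auto simp: cmod_exp_monomial indicator_def)
qed

text \<open>The remainder of the exponential is at most \<open>exp \<bar>h * Re z\<bar> * (cmod (h z))\<^sup>2\<close>, and the factor
  \<open>exp (t * Re z + \<bar>h * Re z\<bar>)\<close> is the exponential at one of the times \<open>t + h\<close> and \<open>t - h\<close>.\<close>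

lemma exp_monomial_taylor:
  assumes "exp_dominated \<delta> t r"
  obtains K where "K \<ge> 0" "\<And>z h. \<bar>h\<bar> \<le> r \<Longrightarrow>
    cmod (exp_monomial \<delta> n (t + h) z - exp_monomial \<delta> n t z - of_real h * exp_monomial \<delta> (Suc n) t z) \<le> K * h\<^sup>2"
proof -
  obtain K where K: "K \<ge> 0"
    "\<And>z s. z \<in> \<delta> \<Longrightarrow> \<bar>s - t\<bar> \<le> r \<Longrightarrow> cmod z ^ (n + 2) * exp (s * Re z) \<le> K"
    using exp_dominatedE[OF assms, of "n + 2"] by blast
  have "cmod (exp_monomial \<delta> n (t + h) z - exp_monomial \<delta> n t z - of_real h * exp_monomial \<delta> (Suc n) t z) \<le> K * h\<^sup>2"
    if h: "\<bar>h\<bar> \<le> r" for z h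
  proof (cases "z \<in> \<delta>")
    case True
    let ?w = "of_real h * z"
    have "exp_monomial \<delta> n (t + h) z - exp_monomial \<delta> n t z - of_real h * exp_monomial \<delta> (Suc n) t z =
        z ^ n * exp (of_real t * z) * (exp ?w - (1 + ?w))"
      using True by (simp add: exp_monomial_def distrib_right exp_add) (simp add: algebra_simps)
    then have "cmod (exp_monomial \<delta> n (t + h) z - exp_monomial \<delta> n t z - of_real h * exp_monomial \<delta> (Suc n) t z) =
        cmod z ^ n * exp (t * Re z) * cmod (exp ?w - (1 + ?w))"
      by (simp add: norm_mult norm_power)
    also have "\<dots> \<le> cmod z ^ n * exp (t * Re z) * (exp \<bar>h * Re z\<bar> * (cmod z ^ 2 * h\<^sup>2))"
    proof (rule mult_left_mono)
      have "cmod (exp ?w - (1 + ?w)) \<le> exp \<bar>Re ?w\<bar> * cmod ?w ^ 2"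
        using Taylor_exp[of ?w 1] by (simp add: numeral_2_eq_2)
      also have "cmod ?w ^ 2 = cmod z ^ 2 * h\<^sup>2"
        by (simp add: norm_mult power_mult_distrib)
      finally show "cmod (exp ?w - (1 + ?w)) \<le> exp \<bar>h * Re z\<bar> * (cmod z ^ 2 * h\<^sup>2)" by simp
    qed simp
    also have "\<dots> = cmod z ^ (n + 2) * exp (t * Re z + \<bar>h * Re z\<bar>) * h\<^sup>2"
      by (simp add: exp_add power_add power2_eq_square mult_ac)
    also have "\<dots> \<le> K * h\<^sup>2"
    proof (rule mult_right_mono)
      obtain s where "\<bar>s - t\<bar> \<le> r" "t * Re z + \<bar>h * Re z\<bar> = s * Re z"
      proof (cases "h * Re z \<ge> 0")
        case True
        then show ?thesis using h by (intro that[of "t + h"]) (auto simp: algebra_simps)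
      next
        case False
        then show ?thesis using h by (intro that[of "t - h"]) (auto simp: algebra_simps)
      qed
      then show "cmod z ^ (n + 2) * exp (t * Re z + \<bar>h * Re z\<bar>) \<le> K"
        using K(2)[OF True] by simp
    qed simp
    finally show ?thesis .
  qed (use K in \<open>simp add: exp_monomial_def\<close>)
  with K(1) show thesis by (rule that)
qed

lemma has_vector_derivative_quadratic_remainder:
  fixes f :: "real \<Rightarrow> 'b::real_normed_vector"
  assumes "r > 0" and bound: "\<And>h. \<bar>h\<bar> \<le> r \<Longrightarrow> norm (f (t + h) - f t - h *\<^sub>R f') \<le> C * h\<^sup>2"
  shows "(f has_vector_derivative f') (at t)"
  unfolding has_vector_derivative_def has_derivative_at
proof
  show "bounded_linear (\<lambda>h. h *\<^sub>R f')" by (rule bounded_linear_scaleR_left)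
  show "(\<lambda>h. norm (f (t + h) - f t - h *\<^sub>R f') / norm h) \<midarrow>0\<rightarrow> 0"
  proof (rule Lim_null_comparison)
    have "\<forall>\<^sub>F h in at 0. \<bar>h :: real\<bar> < r"
      using \<open>r > 0\<close> by (auto simp: eventually_at dist_real_def)
    then show "\<forall>\<^sub>F h in at 0. norm (norm (f (t + h) - f t - h *\<^sub>R f') / norm h) \<le> C * \<bar>h\<bar>"
    proof (rule eventually_mono)
      fix h :: real assume "\<bar>h\<bar> < r"
      then have "norm (f (t + h) - f t - h *\<^sub>R f') \<le> C * \<bar>h\<bar> * \<bar>h\<bar>"
        using bound[of h] by (simp add: power2_eq_square mult.assoc flip: abs_mult)
      then show "norm (norm (f (t + h) - f t - h *\<^sub>R f') / norm h) \<le> C * \<bar>h\<bar>"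
        by (cases "h = 0") (simp_all add: divide_le_eq)
    qed
    show "(\<lambda>h. C * \<bar>h\<bar>) \<midarrow>0\<rightarrow> 0"
      by (auto intro!: tendsto_eq_intros)
  qed
qed

context spectral_measure
begin

lemma \<Phi>_exp_monomial_taylor:
  assumes \<delta>: "\<delta> \<in> sets borel" and dom: "exp_dominated \<delta> t r"
  obtains C where "\<And>h x. \<bar>h\<bar> \<le> r \<Longrightarrow> norm (\<Phi> (exp_monomial \<delta> n (t + h)) x - \<Phi> (exp_monomial \<delta> n t) x
    - h *\<^sub>R \<Phi> (exp_monomial \<delta> (Suc n) t) x) \<le> C * h\<^sup>2 * norm x"
proof -
  obtain K where K: "K \<ge> 0" "\<And>z h. \<bar>h\<bar> \<le> r \<Longrightarrow>
      cmod (exp_monomial \<delta> n (t + h) z - exp_monomial \<delta> n t z - of_real h * exp_monomial \<delta> (Suc n) t z) \<le> K * h\<^sup>2"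
    using exp_monomial_taylor[OF dom] by blast
  show thesis
  proof (rule that)
    fix h x assume h: "\<bar>h\<bar> \<le> r"
    let ?f = "exp_monomial \<delta> n (t + h)" and ?g = "exp_monomial \<delta> n t" and ?g' = "exp_monomial \<delta> (Suc n) t"
    have b: "bounded_borel ?f" "bounded_borel ?g" "bounded_borel ?g'"
      using h by (auto intro!: bounded_borel_exp_monomial[OF \<delta> dom])
    have "\<Phi> ?f x - \<Phi> ?g x - h *\<^sub>R \<Phi> ?g' x = \<Phi> (\<lambda>z. ?f z - ?g z - of_real h * ?g' z) x"
      using b by (simp add: \<Phi>_diff \<Phi>_const_mult bounded_borel_diff bounded_borel_mult
          bounded_borel_const scaleC_of_real)
    also have "norm \<dots> \<le> bound * (K * h\<^sup>2) * norm x"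
      by (intro norm_\<Phi>_le K(2)[OF h] borel_measurable_diff borel_measurable_times
          borel_measurable_const exp_monomial_borel \<delta>)
    finally show "norm (\<Phi> ?f x - \<Phi> ?g x - h *\<^sub>R \<Phi> ?g' x) \<le> (bound * K) * h\<^sup>2 * norm x"
      by (simp add: mult.assoc)
  qed
qed

lemma \<Phi>_exp_monomial_has_derivative:
  assumes \<delta>: "\<delta> \<in> sets borel" and dom: "exp_dominated \<delta> t r" and "r > 0"
  shows "((\<lambda>s. \<Phi> (exp_monomial \<delta> n s) x) has_vector_derivative \<Phi> (exp_monomial \<delta> (Suc n) t) x) (at t)"
proof -
  obtain C where "\<And>h x. \<bar>h\<bar> \<le> r \<Longrightarrow> norm (\<Phi> (exp_monomial \<delta> n (t + h)) x - \<Phi> (exp_monomial \<delta> n t) x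
      - h *\<^sub>R \<Phi> (exp_monomial \<delta> (Suc n) t) x) \<le> C * h\<^sup>2 * norm x"
    using \<Phi>_exp_monomial_taylor[OF \<delta> dom] by blast
  then have "\<bar>h\<bar> \<le> r \<Longrightarrow> norm (\<Phi> (exp_monomial \<delta> n (t + h)) x - \<Phi> (exp_monomial \<delta> n t) x
      - h *\<^sub>R \<Phi> (exp_monomial \<delta> (Suc n) t) x) \<le> (C * norm x) * h\<^sup>2" for h
    by (simp add: mult_ac)
  then show ?thesis by (rule has_vector_derivative_quadratic_remainder[OF \<open>r > 0\<close>])
qed

lemma Blinfun_\<Phi>_apply: "bounded_borel F \<Longrightarrow> blinfun_apply (Blinfun (\<Phi> F)) x = \<Phi> F x"
  by (simp add: bounded_linear_Blinfun_apply bounded_linear_\<Phi>)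

text \<open>The derivative exists in the operator norm, so that it can enter a product rule with a vector
  that depends on \<open>s\<close> as well.\<close>

lemma Blinfun_\<Phi>_exp_has_derivative:
  assumes \<delta>: "\<delta> \<in> sets borel" "bounded \<delta>"
  shows "((\<lambda>s. Blinfun (\<Phi> (exp_monomial \<delta> 0 (- s)))) has_vector_derivative
    - Blinfun (\<Phi> (exp_monomial \<delta> 1 (- s)))) (at s)"
proof -
  note dom = exp_dominated_bounded[OF \<delta>(2)]
  let ?B = "\<lambda>n t. Blinfun (\<Phi> (exp_monomial \<delta> n t))"
  have B_apply: "blinfun_apply (?B n t) x = \<Phi> (exp_monomial \<delta> n t) x" for n t x
    using bounded_borel_exp_monomial[OF \<delta>(1) dom[of t 1], of t n] by (intro Blinfun_\<Phi>_apply) simp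
  obtain C where C: "\<And>h x. \<bar>h\<bar> \<le> 1 \<Longrightarrow> norm (\<Phi> (exp_monomial \<delta> 0 (- s + h)) x - \<Phi> (exp_monomial \<delta> 0 (- s)) x
      - h *\<^sub>R \<Phi> (exp_monomial \<delta> (Suc 0) (- s)) x) \<le> C * h\<^sup>2 * norm x"
    using \<Phi>_exp_monomial_taylor[OF \<delta>(1) dom] by blast
  have "(?B 0 has_vector_derivative ?B 1 (- s)) (at (- s))"
  proof (rule has_vector_derivative_quadratic_remainder[of 1])
    fix h :: real assume h: "\<bar>h\<bar> \<le> 1"
    show "norm (?B 0 (- s + h) - ?B 0 (- s) - h *\<^sub>R ?B 1 (- s)) \<le> \<bar>C\<bar> * h\<^sup>2"
    proof (rule norm_blinfun_bound)
      fix x :: 'a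
      have "C * h\<^sup>2 * norm x \<le> \<bar>C\<bar> * h\<^sup>2 * norm x" by (intro mult_right_mono) auto
      with C[OF h, of x]
      show "norm (blinfun_apply (?B 0 (- s + h) - ?B 0 (- s) - h *\<^sub>R ?B 1 (- s)) x) \<le> \<bar>C\<bar> * h\<^sup>2 * norm x"
        by (simp add: blinfun.diff_left blinfun.scaleR_left B_apply)
    qed simp
  qed simp
  moreover have "(uminus has_vector_derivative - 1) (at s)"
    by (rule has_vector_derivative_minus[OF has_vector_derivative_id])
  ultimately show ?thesis
    using vector_diff_chain_at[where f = uminus and f' = "- 1" and x = s] by (fastforce simp: o_def)
qed

lemma \<Phi>_exp_product_rule:
  assumes \<delta>: "\<delta> \<in> sets borel" "bounded \<delta>" and g: "(g has_vector_derivative g') (at s)"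
  shows "((\<lambda>s. \<Phi> (exp_monomial \<delta> 0 (- s)) (g s)) has_vector_derivative
    \<Phi> (exp_monomial \<delta> 0 (- s)) g' - \<Phi> (exp_monomial \<delta> 1 (- s)) (g s)) (at s)"
proof -
  have b: "bounded_borel (exp_monomial \<delta> n (- s))" for n s
    by (rule bounded_borel_exp_monomial[OF \<delta>(1) exp_dominated_bounded[OF \<delta>(2), of "- s" 1]]) simp
  from bounded_bilinear.has_vector_derivative[OF bounded_bilinear_blinfun_apply
      Blinfun_\<Phi>_exp_has_derivative[OF \<delta>] g]
  show ?thesis by (simp add: Blinfun_\<Phi>_apply b blinfun.minus_left)
qed

lemma \<Phi>_exp_continuous:
  assumes \<delta>: "\<delta> \<in> sets borel" "bounded \<delta>" and g: "continuous_on X g"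
  shows "continuous_on X (\<lambda>s. \<Phi> (exp_monomial \<delta> 0 (- s)) (g s))"
proof -
  have b: "bounded_borel (exp_monomial \<delta> n (- s))" for n s
    by (rule bounded_borel_exp_monomial[OF \<delta>(1) exp_dominated_bounded[OF \<delta>(2), of "- s" 1]]) simp
  have "continuous_on X (\<lambda>s. Blinfun (\<Phi> (exp_monomial \<delta> 0 (- s))))"
    using Blinfun_\<Phi>_exp_has_derivative[OF \<delta>]
    by (intro continuous_at_imp_continuous_on ballI) (blast intro: has_vector_derivative_continuous)
  from bounded_bilinear.continuous_on[OF bounded_bilinear_blinfun_apply this g]
  show ?thesis by (simp add: Blinfun_\<Phi>_apply b)
qed

end

section \<open>The semigroup of an operator with spectrum in a half-plane\<close>

context scalar_type_operator
begin

lemma bounded_borel_exp: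
  assumes "\<And>z. z \<in> \<sigma> \<Longrightarrow> Re z \<le> \<omega>" "t \<ge> 0"
  shows "bounded_borel (exp_monomial \<sigma> 0 t)"
proof (rule bounded_borelI)
  show "cmod (exp_monomial \<sigma> 0 t z) \<le> exp (t * \<omega>)" for z
    using assms by (auto simp: cmod_exp_monomial indicator_def intro: mult_left_mono)
qed simp

lemma exp_monomial_zero: "exp_monomial \<delta> 0 0 = indicator \<delta>"
  by (auto simp: exp_monomial_def)

lemma exp_monomial_add: "exp_monomial \<delta> 0 (s + t) = (\<lambda>z. exp_monomial \<delta> 0 s z * exp_monomial \<delta> 0 t z)"
  by (auto simp: exp_monomial_def indicator_def distrib_right exp_add)

lemma semigroup_exp:
  assumes \<omega>: "\<And>z. z \<in> \<sigma> \<Longrightarrow> Re z \<le> \<omega>"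
  shows "C0_semigroup (\<lambda>t. \<Phi> (exp_monomial \<sigma> 0 t))"
proof
  show "bounded_clinear (\<Phi> (exp_monomial \<sigma> 0 t))" if "t \<ge> 0" for t
    by (rule bounded_clinear_\<Phi>[OF bounded_borel_exp[OF \<omega> that]])
  show "\<Phi> (exp_monomial \<sigma> 0 0) = id"
    by (simp add: exp_monomial_zero \<Phi>_indicator E_spectrum fun_eq_iff)
  show "\<Phi> (exp_monomial \<sigma> 0 (s + t)) = \<Phi> (exp_monomial \<sigma> 0 s) \<circ> \<Phi> (exp_monomial \<sigma> 0 t)"
    if "s \<ge> 0" "t \<ge> 0" for s t
    unfolding exp_monomial_add
    using \<Phi>_mult[OF bounded_borel_exp[OF \<omega> that(1)] bounded_borel_exp[OF \<omega> that(2)]]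
    by (simp add: fun_eq_iff)
  show "continuous_on {0..} (\<lambda>t. \<Phi> (exp_monomial \<sigma> 0 t) x)" for x
  proof (rule continuous_on_sequentiallyI)
    fix u :: "nat \<Rightarrow> real" and a
    assume u: "\<forall>n. u n \<in> {0..}" "u \<longlonglongrightarrow> a"
    obtain B where B: "\<And>n. \<bar>u n\<bar> \<le> B"
      using convergent_imp_Bseq[of u] u(2) by (auto simp: convergent_def Bseq_def)
    show "(\<lambda>n. \<Phi> (exp_monomial \<sigma> 0 (u n)) x) \<longlonglongrightarrow> \<Phi> (exp_monomial \<sigma> 0 a) x"
    proof (rule \<Phi>_dominated_convergence)
      fix n z
      have "u n * Re z \<le> B * \<bar>\<omega>\<bar>" if "z \<in> \<sigma>"
      proof -
        have "u n * Re z \<le> u n * \<bar>\<omega>\<bar>"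
          using \<omega>[OF that] u(1) by (intro mult_left_mono) auto
        also have "\<dots> \<le> B * \<bar>\<omega>\<bar>" using B[of n] by (intro mult_right_mono) auto
        finally show ?thesis .
      qed
      then show "cmod (exp_monomial \<sigma> 0 (u n) z) \<le> exp (B * \<bar>\<omega>\<bar>)"
        by (auto simp: cmod_exp_monomial indicator_def)
      show "(\<lambda>n. exp_monomial \<sigma> 0 (u n) z) \<longlonglongrightarrow> exp_monomial \<sigma> 0 a z"
        unfolding exp_monomial_def by (intro tendsto_intros u)
    qed simp
  qed
qed

text \<open>The symbol of the operator that maps \<open>A x\<close> to the difference quotient of the semigroup at \<open>x\<close>; the
  value \<open>1\<close> at \<open>z = 0\<close> is the continuous extension.\<close>

definition exp_quotient :: "real \<Rightarrow> complex \<Rightarrow> complex"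
  where "exp_quotient h z =
    (if z = 0 then 1 else (exp (of_real h * z) - 1) / (of_real h * z)) * indicator \<sigma> z"

lemma exp_quotient_borel [measurable]: "exp_quotient h \<in> borel_measurable borel"
  unfolding exp_quotient_def[abs_def] by measurable

text \<open>The Taylor bound serves for \<open>Re w \<ge> - 1\<close>. Further to the left \<open>exp w - 1\<close> is bounded by \<open>2\<close>, while \<open>w\<close>
  has modulus at least \<open>1\<close>.\<close>

lemma cmod_exp_diff_one_le:
  assumes "Re w \<le> \<omega>"
  shows "cmod (exp w - 1) \<le> 2 * exp (1 + \<bar>\<omega>\<bar>) * cmod w"
proof (cases "Re w \<ge> - 1")
  case True
  have "cmod (exp w - 1) \<le> exp \<bar>Re w\<bar> * cmod w"
    using Taylor_exp[of w 0] by simp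
  also have "\<dots> \<le> exp (1 + \<bar>\<omega>\<bar>) * cmod w"
    using True assms by (intro mult_right_mono) auto
  also have "\<dots> \<le> 2 * exp (1 + \<bar>\<omega>\<bar>) * cmod w" by simp
  finally show ?thesis .
next
  case False
  have "cmod (exp w - 1) \<le> exp (Re w) + 1"
    using norm_triangle_ineq4[of "exp w" 1] by simp
  also have "\<dots> \<le> 2" using False by simp
  also have "\<dots> \<le> 2 * exp (1 + \<bar>\<omega>\<bar>) * cmod w"
  proof -
    have "1 \<le> exp (1 + \<bar>\<omega>\<bar>)" by simp
    moreover have "1 \<le> cmod w" using False abs_Re_le_cmod[of w] by linarith
    ultimately have "1 * 1 \<le> exp (1 + \<bar>\<omega>\<bar>) * cmod w" by (intro mult_mono) auto
    then show ?thesis by simp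
  qed
  finally show ?thesis .
qed

lemma cmod_exp_quotient_le:
  assumes \<omega>: "\<And>z. z \<in> \<sigma> \<Longrightarrow> Re z \<le> \<omega>" and h: "0 < h" "h \<le> 1"
  shows "cmod (exp_quotient h z) \<le> 2 * exp (1 + \<bar>\<omega>\<bar>)"
proof (cases "z \<in> \<sigma> \<and> z \<noteq> 0")
  case True
  have "h * Re z \<le> h * \<bar>\<omega>\<bar>" using \<omega>[of z] True h by (intro mult_left_mono) auto
  also have "\<dots> \<le> \<bar>\<omega>\<bar>" using h by (simp add: mult_left_le_one_le)
  finally have "cmod (exp (of_real h * z) - 1) \<le> 2 * exp (1 + \<bar>\<omega>\<bar>) * cmod (of_real h * z)"
    using cmod_exp_diff_one_le[of "of_real h * z" "\<bar>\<omega>\<bar>"] by simp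
  moreover have "cmod (of_real h * z) > 0" using True h by simp
  ultimately show ?thesis
    using True by (simp add: exp_quotient_def norm_divide divide_le_eq)
next
  case False
  have "1 \<le> exp (1 + \<bar>\<omega>\<bar>)" by simp
  then have "1 \<le> 2 * exp (1 + \<bar>\<omega>\<bar>)" by linarith
  then show ?thesis using False by (auto simp: exp_quotient_def indicator_def)
qed

lemma exp_quotient_tendsto_one:
  assumes h: "\<And>n. 0 < h n" "h \<longlonglongrightarrow> 0"
  shows "(\<lambda>n. exp_quotient (h n) z) \<longlonglongrightarrow> indicator \<sigma> z"
proof (cases "z = 0")
  case False
  have "((\<lambda>w :: complex. (exp w - 1) / w) \<longlongrightarrow> 1) (at 0)"
    using DERIV_exp[of "0 :: complex"] by (simp add: DERIV_def)
  moreover have "filterlim (\<lambda>n. of_real (h n) * z) (at 0) sequentially"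
  proof (rule filterlim_atI)
    have "(\<lambda>n. of_real (h n) * z) \<longlonglongrightarrow> of_real 0 * z"
      by (intro tendsto_intros h)
    then show "(\<lambda>n. of_real (h n) * z) \<longlonglongrightarrow> 0" by simp
    show "\<forall>\<^sub>F n in sequentially. of_real (h n) * z \<noteq> 0"
      using h(1) False by (auto simp: less_imp_neq[symmetric])
  qed
  ultimately have "(\<lambda>n. (exp (of_real (h n) * z) - 1) / (of_real (h n) * z)) \<longlonglongrightarrow> 1"
    by (rule filterlim_compose)
  from tendsto_mult[OF this tendsto_const[of "indicator \<sigma> z"]] show ?thesis
    using False by (simp add: exp_quotient_def)
qed (simp add: exp_quotient_def)

lemma \<Phi>_exp_quotient_tendsto:
  assumes \<omega>: "\<And>z. z \<in> \<sigma> \<Longrightarrow> Re z \<le> \<omega>"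
  shows "((\<lambda>h. \<Phi> (exp_quotient h) x) \<longlongrightarrow> x) (at_right 0)"
proof (rule tendsto_at_right_sequentially[of 0 1])
  fix h :: "nat \<Rightarrow> real"
  assume h: "\<And>n. 0 < h n" "\<And>n. h n < 1" "h \<longlonglongrightarrow> 0"
  have "(\<lambda>n. \<Phi> (exp_quotient (h n)) x) \<longlonglongrightarrow> \<Phi> (indicator \<sigma>) x"
  proof (rule \<Phi>_dominated_convergence)
    show "cmod (exp_quotient (h n) z) \<le> 2 * exp (1 + \<bar>\<omega>\<bar>)" for n z
      using h by (intro cmod_exp_quotient_le[OF \<omega>]) (auto intro: less_imp_le)
    show "(\<lambda>n. exp_quotient (h n) z) \<longlonglongrightarrow> indicator \<sigma> z" for z
      using h by (intro exp_quotient_tendsto_one)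
  qed simp
  then show "(\<lambda>n. \<Phi> (exp_quotient (h n)) x) \<longlonglongrightarrow> x"
    by (simp add: \<Phi>_indicator E_spectrum)
qed simp

text \<open>With \<open>G\<close> the quotient \<open>exp_quotient h\<close>, one has \<open>(S h x - x) / h = \<Phi> G (A x)\<close> on the domain, which tends to \<open>A x\<close>.
  Conversely, if the difference quotient tends to \<open>y\<close>, then its projection to a bounded part of
  the spectrum is \<open>\<Phi> G (T n x)\<close>. This yields \<open>T n x = E (part n) y\<close>, which tends to \<open>y\<close>, so that \<open>x\<close> lies in
  the domain of \<open>A\<close>.\<close>

lemma generator_exp:
  assumes \<omega>: "\<And>z. z \<in> \<sigma> \<Longrightarrow> Re z \<le> \<omega>"
  shows "is_generator (\<lambda>t. \<Phi> (exp_monomial \<sigma> 0 t)) D A"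
proof -
  let ?S = "\<lambda>t. \<Phi> (exp_monomial \<sigma> 0 t)"
  define H where "H h z = of_real (1 / h) * (exp_monomial \<sigma> 0 h z - indicator \<sigma> z)" for h :: real and z
  have bI: "bounded_borel (indicator \<sigma>)" by (rule bounded_borel_indicator) simp
  have G: "bounded_borel (exp_quotient h)" if "0 < h" "h < 1" for h
    using that by (intro bounded_borelI[OF _ cmod_exp_quotient_le[OF \<omega>]]) auto
  have H: "bounded_borel (H h)" if "0 < h" for h
    unfolding H_def using that
    by (intro bounded_borel_mult bounded_borel_const bounded_borel_diff bounded_borel_exp[OF \<omega>] bI) auto
  have HG: "H h z = z * exp_quotient h z" if "0 < h" "z \<in> \<sigma>" for h z
    using that by (simp add: H_def exp_quotient_def exp_monomial_def field_simps)
  have \<Phi>H: "\<Phi> (H h) x = (1 / h) *\<^sub>R (?S h x - x)" if "0 < h" for h x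
  proof -
    have "\<Phi> (H h) x = of_real (1 / h) *\<^sub>C \<Phi> (\<lambda>z. exp_monomial \<sigma> 0 h z - indicator \<sigma> z) x"
      unfolding H_def using that
      by (intro \<Phi>_const_mult bounded_borel_diff bounded_borel_exp[OF \<omega>] bI) auto
    also have "\<dots> = (1 / h) *\<^sub>R (?S h x - \<Phi> (indicator \<sigma>) x)"
      unfolding scaleC_of_real using that
      by (subst \<Phi>_diff[OF bounded_borel_exp[OF \<omega>] bI]) auto
    finally show ?thesis by (simp add: \<Phi>_indicator E_spectrum)
  qed
  have small: "\<forall>\<^sub>F h in at_right (0::real). 0 < h \<and> h < 1"
    by (auto simp: eventually_at_right_field intro: exI[of _ 1])
  have A: "((\<lambda>h. (1 / h) *\<^sub>R (?S h x - x)) \<longlongrightarrow> A x) (at_right 0)" if "x \<in> D" for x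
  proof (rule Lim_transform_eventually[OF \<Phi>_exp_quotient_tendsto[OF \<omega>]])
    show "\<forall>\<^sub>F h in at_right 0. \<Phi> (exp_quotient h) (A x) = (1 / h) *\<^sub>R (?S h x - x)"
      using small
    proof (rule eventually_mono)
      fix h :: real assume h: "0 < h \<and> h < 1"
      have "\<Phi> (exp_quotient h) (A x) = \<Phi> (H h) x"
        using h that by (intro \<Phi>_A G H HG) auto
      then show "\<Phi> (exp_quotient h) (A x) = (1 / h) *\<^sub>R (?S h x - x)"
        using h by (simp add: \<Phi>H)
    qed
  qed
  have D: "x \<in> D" if lim: "((\<lambda>h. (1 / h) *\<^sub>R (?S h x - x)) \<longlongrightarrow> y) (at_right 0)" for x y
  proof (rule domainI(1))
    have "T n x = E (part n) y" for n
    proof (rule tendsto_unique[OF trivial_limit_at_right_real \<Phi>_exp_quotient_tendsto[OF \<omega>]])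
      have "((\<lambda>h. E (part n) ((1 / h) *\<^sub>R (?S h x - x))) \<longlongrightarrow> E (part n) y) (at_right 0)"
        by (rule bounded_linear.tendsto[OF bounded_linear_E lim]) simp
      then show "((\<lambda>h. \<Phi> (exp_quotient h) (T n x)) \<longlongrightarrow> E (part n) y) (at_right 0)"
      proof (rule Lim_transform_eventually)
        show "\<forall>\<^sub>F h in at_right 0. E (part n) ((1 / h) *\<^sub>R (?S h x - x)) = \<Phi> (exp_quotient h) (T n x)"
          using small
        proof (rule eventually_mono)
          fix h :: real assume h: "0 < h \<and> h < 1"
          have "\<Phi> (exp_quotient h) (T n x) = \<Phi> (H h) (E (part n) x)"
            using h by (intro \<Phi>_T G H HG) auto
          also have "\<dots> = E (part n) (\<Phi> (H h) x)"
            using h by (intro \<Phi>_mult_indicator(2) H) auto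
          finally show "E (part n) ((1 / h) *\<^sub>R (?S h x - x)) = \<Phi> (exp_quotient h) (T n x)"
            using h by (simp add: \<Phi>H)
        qed
      qed
    qed
    then show "(\<lambda>n. T n x) \<longlonglongrightarrow> y" using E_part_tendsto by simp
  qed
  show ?thesis unfolding is_generator_def using A D by blast
qed

section \<open>Derivatives of the orbits\<close>

lemma higher_derivative_exp:
  assumes dom: "\<And>t. t > 0 \<Longrightarrow> exp_dominated \<sigma> t (t / 2)" and "t > 0"
  shows "higher_vector_derivative n (\<lambda>t. \<Phi> (exp_monomial \<sigma> 0 t) x) t = \<Phi> (exp_monomial \<sigma> n t) x"
    and "(higher_vector_derivative n (\<lambda>t. \<Phi> (exp_monomial \<sigma> 0 t) x) has_vector_derivative
      \<Phi> (exp_monomial \<sigma> (Suc n) t) x) (at t)"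
proof -
  let ?g = "\<lambda>t. \<Phi> (exp_monomial \<sigma> 0 t) x"
  have deriv: "((\<lambda>s. \<Phi> (exp_monomial \<sigma> n s) x) has_vector_derivative \<Phi> (exp_monomial \<sigma> (Suc n) t) x) (at t)"
    if "t > 0" for n t
    using that by (intro \<Phi>_exp_monomial_has_derivative[OF _ dom]) auto
  have "\<forall>t>0. higher_vector_derivative n ?g t = \<Phi> (exp_monomial \<sigma> n t) x \<and>
      (higher_vector_derivative n ?g has_vector_derivative \<Phi> (exp_monomial \<sigma> (Suc n) t) x) (at t)"
  proof (induction n)
    case 0
    then show ?case using deriv[of _ 0] by (simp add: higher_vector_derivative_def)
  next
    case (Suc n)
    have eq: "higher_vector_derivative (Suc n) ?g t = \<Phi> (exp_monomial \<sigma> (Suc n) t) x" if "t > 0" for t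
    proof -
      have "higher_vector_derivative (Suc n) ?g t = vector_derivative (higher_vector_derivative n ?g) (at t)"
        by (simp add: higher_vector_derivative_def)
      then show ?thesis using Suc that by (simp add: vector_derivative_at)
    qed
    moreover have "(higher_vector_derivative (Suc n) ?g has_vector_derivative
        \<Phi> (exp_monomial \<sigma> (Suc (Suc n)) t) x) (at t)" if "t > 0" for t
      by (rule has_vector_derivative_transform_within_open[OF deriv[OF that, of "Suc n"], of "{0<..}"])
        (use that eq in auto)
    ultimately show ?case by blast
  qed
  with \<open>t > 0\<close> show "higher_vector_derivative n ?g t = \<Phi> (exp_monomial \<sigma> n t) x"
    "(higher_vector_derivative n ?g has_vector_derivative \<Phi> (exp_monomial \<sigma> (Suc n) t) x) (at t)"
    by blast+
qed

lemma gevrey_beurling_exp: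
  assumes estimate: "\<And>p q \<alpha>. 0 < p \<Longrightarrow> 0 < \<alpha> \<Longrightarrow> \<exists>c>0. \<forall>n. \<forall>z\<in>\<sigma>. \<forall>s\<in>{p..q}.
    cmod z ^ n * exp (s * Re z) \<le> c * \<alpha> ^ n * fact n powr \<beta>"
  shows "gevrey_beurling \<beta> (\<lambda>t. \<Phi> (exp_monomial \<sigma> 0 t) x)"
proof -
  have dom: "exp_dominated \<sigma> t (t / 2)" if "t > 0" for t
    unfolding exp_dominated_def
  proof
    fix n
    have "\<exists>c>0. \<forall>n. \<forall>z\<in>\<sigma>. \<forall>s\<in>{t / 2..3 * t / 2}.
        cmod z ^ n * exp (s * Re z) \<le> c * 1 ^ n * fact n powr \<beta>"
      using that by (intro estimate) auto
    then obtain c where c: "\<And>n z s. z \<in> \<sigma> \<Longrightarrow> s \<in> {t / 2..3 * t / 2} \<Longrightarrow>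
        cmod z ^ n * exp (s * Re z) \<le> c * 1 ^ n * fact n powr \<beta>"
      by blast
    show "\<exists>K. \<forall>z\<in>\<sigma>. \<forall>s. \<bar>s - t\<bar> \<le> t / 2 \<longrightarrow> cmod z ^ n * exp (s * Re z) \<le> K"
    proof (intro exI ballI allI impI)
      fix z s assume "z \<in> \<sigma>" "\<bar>s - t\<bar> \<le> t / 2"
      then show "cmod z ^ n * exp (s * Re z) \<le> c * 1 ^ n * fact n powr \<beta>"
        by (intro c) (simp_all only: atLeastAtMost_iff, linarith)
    qed
  qed
  show ?thesis
    unfolding gevrey_beurling_def
  proof (intro conjI allI impI)
    show "infinitely_differentiable_on (\<lambda>t. \<Phi> (exp_monomial \<sigma> 0 t) x) {0<..}"
      unfolding infinitely_differentiable_on_def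
      using higher_derivative_exp(2)[OF dom] by (auto intro: differentiableI_vector)
    fix p q \<alpha> :: real assume pq: "0 < p \<and> p \<le> q" and \<alpha>: "\<alpha> > 0"
    then obtain c where c: "c > 0" "\<And>n z s. z \<in> \<sigma> \<Longrightarrow> s \<in> {p..q} \<Longrightarrow>
        cmod z ^ n * exp (s * Re z) \<le> c * \<alpha> ^ n * fact n powr \<beta>"
      using estimate[of p \<alpha> q] by blast
    show "\<exists>c>0. \<forall>n. \<forall>t\<in>{p..q}.
        norm (higher_vector_derivative n (\<lambda>t. \<Phi> (exp_monomial \<sigma> 0 t) x) t) \<le> c * \<alpha> ^ n * fact n powr \<beta>"
    proof (intro exI conjI allI ballI)
      show "bound * c * (norm x + 1) > 0"
        using bound_pos c(1) by (intro mult_pos_pos add_nonneg_pos) auto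
      fix n t assume t: "t \<in> {p..q}"
      have "cmod (exp_monomial \<sigma> n t z) \<le> c * \<alpha> ^ n * fact n powr \<beta>" for z
        using c(2)[OF _ t, of z n] c(1) \<alpha> by (auto simp: cmod_exp_monomial indicator_def)
      then have "norm (\<Phi> (exp_monomial \<sigma> n t) x) \<le> bound * (c * \<alpha> ^ n * fact n powr \<beta>) * norm x"
        by (intro norm_\<Phi>_le) auto
      also have "\<dots> \<le> bound * (c * \<alpha> ^ n * fact n powr \<beta>) * (norm x + 1)"
        using bound_pos c(1) \<alpha> by (intro mult_left_mono) auto
      also have "\<dots> = bound * c * (norm x + 1) * \<alpha> ^ n * fact n powr \<beta>"
        by (simp only: mult_ac)
      finally show "norm (higher_vector_derivative n (\<lambda>t. \<Phi> (exp_monomial \<sigma> 0 t) x) t)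
          \<le> bound * c * (norm x + 1) * \<alpha> ^ n * fact n powr \<beta>"
        using t pq by (subst higher_derivative_exp(1)[OF dom]) auto
    qed
  qed
qed

end

section \<open>Powers against factorials\<close>

lemma power_le_fact_mult_exp:
  fixes x :: real
  assumes "x \<ge> 0"
  shows "x ^ n \<le> fact n * exp x"
proof -
  have "(\<Sum>i\<in>{n}. x ^ i /\<^sub>R fact i) \<le> exp x"
    unfolding sums_unique[OF exp_converges]
    using assms by (intro sum_le_suminf sums_summable[OF exp_converges]) auto
  then show ?thesis by (simp add: field_simps)
qed

lemma power_mult_exp_minus_le:
  fixes x :: real
  assumes "x \<ge> 0"
  shows "x ^ n * exp (- x) \<le> fact n"
  using power_le_fact_mult_exp[OF assms, of n] by (simp add: exp_minus field_simps)

lemma power_powr_commute: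
  fixes x :: real
  assumes "x \<ge> 0"
  shows "(x powr a) ^ n = (x ^ n) powr a"
  using assms by (induction n) (simp_all add: powr_mult)

lemma power_le_fact_powr:
  fixes K \<gamma> :: real
  assumes "K \<ge> 0" "\<gamma> > 0"
  shows "\<exists>c>0. \<forall>n. K ^ n \<le> c * fact n powr \<gamma>"
proof (intro exI conjI allI)
  let ?k = "K powr (1 / \<gamma>)"
  show "exp ?k powr \<gamma> > 0" by simp
  fix n
  have "K ^ n = (?k ^ n) powr \<gamma>"
    using assms by (simp add: power_powr_commute powr_powr)
  also have "\<dots> \<le> (fact n * exp ?k) powr \<gamma>"
    using assms by (intro powr_mono2 power_le_fact_mult_exp) auto
  also have "\<dots> = exp ?k powr \<gamma> * fact n powr \<gamma>"
    by (simp add: powr_mult)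
  finally show "K ^ n \<le> exp ?k powr \<gamma> * fact n powr \<gamma>" .
qed

text \<open>To the left of the imaginary axis \<open>\<bar>x\<bar> ^ n * exp (p * x)\<close> is at most \<open>fact n / p ^ n\<close>;
  to the right \<open>x\<close> lies between \<open>0\<close> and \<open>a\<close>. The remaining factor
  \<open>fact n powr (\<beta> - 1)\<close> absorbs any geometric growth; this is where \<open>\<beta> > 1\<close> enters.\<close>

lemma gevrey_estimate_Re:
  fixes \<beta> :: real
  assumes "\<beta> > 1" "a \<ge> 0" "p > 0" "\<alpha> > 0"
  shows "\<exists>c>0. \<forall>n x s. x \<le> a \<longrightarrow> s \<in> {p..q} \<longrightarrow> \<bar>x\<bar> ^ n * exp (s * x) \<le> c * \<alpha> ^ n * fact n powr \<beta>"
proof -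
  define R where "R = a + 1 / p"
  have R: "R \<ge> 0" using assms by (simp add: R_def)
  obtain c where c: "c > 0" "\<And>n. (R / \<alpha>) ^ n \<le> c * fact n powr (\<beta> - 1)"
    using power_le_fact_powr[of "R / \<alpha>" "\<beta> - 1"] assms R by auto
  show ?thesis
  proof (intro exI conjI allI impI)
    show "exp (q * a) * c > 0" using c by simp
    fix n :: nat and x s :: real
    assume x: "x \<le> a" and s: "s \<in> {p..q}"
    have qa: "1 \<le> exp (q * a)" using assms s by simp
    have "\<bar>x\<bar> ^ n * exp (s * x) \<le> exp (q * a) * (fact n * R ^ n)"
    proof (cases "x \<ge> 0")
      case True
      have "s * x \<le> q * a" using True x s assms by (intro mult_mono) auto
      moreover have "\<bar>x\<bar> ^ n \<le> R ^ n" using True x assms by (intro power_mono) (auto simp: R_def add_increasing2)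
      ultimately have "\<bar>x\<bar> ^ n * exp (s * x) \<le> (1 * R ^ n) * exp (q * a)"
        using R by (intro mult_mono) auto
      also have "\<dots> \<le> (fact n * R ^ n) * exp (q * a)"
        using R fact_ge_1[of n] by (intro mult_right_mono) auto
      finally show ?thesis by (simp add: mult_ac)
    next
      case False
      have "\<bar>x\<bar> ^ n * exp (s * x) \<le> \<bar>x\<bar> ^ n * exp (- (p * \<bar>x\<bar>))"
        using False s by (intro mult_left_mono) (auto intro: mult_right_mono_neg)
      also have "\<dots> = (1 / p) ^ n * ((p * \<bar>x\<bar>) ^ n * exp (- (p * \<bar>x\<bar>)))"
        using assms by (simp add: power_mult_distrib power_divide)
      also have "\<dots> \<le> R ^ n * fact n"
      proof (rule mult_mono)
        show "(1 / p) ^ n \<le> R ^ n" using assms by (intro power_mono) (auto simp: R_def)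
        show "(p * \<bar>x\<bar>) ^ n * exp (- (p * \<bar>x\<bar>)) \<le> fact n"
          using assms by (intro power_mult_exp_minus_le) auto
      qed (use assms R in auto)
      also have "\<dots> \<le> exp (q * a) * (fact n * R ^ n)"
        using mult_right_mono[OF qa, of "fact n * R ^ n"] R by (simp add: mult.commute)
      finally show ?thesis .
    qed
    also have "R ^ n = (R / \<alpha>) ^ n * \<alpha> ^ n" using assms by (simp add: power_divide)
    also have "exp (q * a) * (fact n * ((R / \<alpha>) ^ n * \<alpha> ^ n)) \<le>
        exp (q * a) * (fact n * ((c * fact n powr (\<beta> - 1)) * \<alpha> ^ n))"
      using assms c by (intro mult_left_mono mult_right_mono) auto
    also have "\<dots> = exp (q * a) * c * \<alpha> ^ n * fact n powr \<beta>"
    proof -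
      have "(fact n :: real) powr \<beta> = fact n powr (1 + (\<beta> - 1))" by simp
      also have "\<dots> = fact n * fact n powr (\<beta> - 1)" by (subst powr_add) simp
      finally show ?thesis by (simp add: mult_ac)
    qed
    finally show "\<bar>x\<bar> ^ n * exp (s * x) \<le> exp (q * a) * c * \<alpha> ^ n * fact n powr \<beta>" .
  qed
qed

text \<open>With \<open>u = \<bar>y\<bar> powr (1 / \<beta>)\<close> the estimate is the \<open>\<beta>\<close>-th power of \<open>v ^ n * exp (- v) \<le> fact n\<close> for
  \<open>v = p * b * u / \<beta>\<close>; the value of \<open>b\<close> is the one for which rescaling \<open>u\<close> to \<open>v\<close> costs \<open>\<alpha> ^ n\<close>.\<close>

lemma gevrey_estimate_Im:
  fixes \<beta> :: real
  assumes "\<beta> > 0" "p > 0" "\<alpha> > 0" and b: "b = \<beta> / (p * \<alpha> powr (1 / \<beta>))"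
    and "a \<ge> 0" "s \<in> {p..q}" "x \<le> a - b * \<bar>y\<bar> powr (1 / \<beta>)"
  shows "\<bar>y\<bar> ^ n * exp (s * x) \<le> exp (q * a) * \<alpha> ^ n * fact n powr \<beta>"
proof -
  define u where "u = \<bar>y\<bar> powr (1 / \<beta>)"
  have u: "u \<ge> 0" "\<bar>y\<bar> = u powr \<beta>" using assms(1) by (auto simp: u_def powr_powr)
  have "b > 0" using assms by simp
  have "s * x \<le> s * (a - b * u)" using assms by (intro mult_left_mono) (auto simp: u_def)
  also have "\<dots> = s * a - s * (b * u)" by (simp add: algebra_simps)
  also have "\<dots> \<le> q * a - p * (b * u)"
    using assms u \<open>b > 0\<close> by (intro diff_mono mult_right_mono) auto
  finally have "exp (s * x) \<le> exp (q * a) * exp (- (p * (b * u)))"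
    by (simp flip: exp_add)
  then have "\<bar>y\<bar> ^ n * exp (s * x) \<le> \<bar>y\<bar> ^ n * (exp (q * a) * exp (- (p * (b * u))))"
    by (intro mult_left_mono) auto
  also have "\<dots> = exp (q * a) * (u ^ n * exp (- (p * b * u / \<beta>))) powr \<beta>"
  proof -
    have "exp (- (p * (b * u))) = exp (- (p * b * u / \<beta>)) powr \<beta>"
      using assms by (simp add: powr_def)
    then show ?thesis
      unfolding u(2) power_powr_commute[OF u(1)] by (simp add: powr_mult)
  qed
  also have "u ^ n * exp (- (p * b * u / \<beta>)) =
      (\<alpha> powr (1 / \<beta>)) ^ n * ((p * b * u / \<beta>) ^ n * exp (- (p * b * u / \<beta>)))"
  proof -
    have "u = \<alpha> powr (1 / \<beta>) * (p * b * u / \<beta>)"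
      using assms by simp
    then show ?thesis by (metis mult.assoc power_mult_distrib)
  qed
  also have "exp (q * a) * (\<dots>) powr \<beta> \<le> exp (q * a) * ((\<alpha> powr (1 / \<beta>)) ^ n * fact n) powr \<beta>"
  proof (intro mult_left_mono powr_mono2)
    show "(p * b * u / \<beta>) ^ n * exp (- (p * b * u / \<beta>)) \<le> fact n"
      using assms u \<open>b > 0\<close> by (intro power_mult_exp_minus_le) auto
  qed (use assms u \<open>b > 0\<close> in auto)
  also have "((\<alpha> powr (1 / \<beta>)) ^ n * fact n) powr \<beta> = \<alpha> ^ n * fact n powr \<beta>"
    using assms by (simp add: powr_mult power_powr_commute powr_powr)
  finally show ?thesis by (simp add: mult.assoc)
qed

lemma gevrey_estimate:
  fixes \<beta> :: real and \<Sigma> :: "complex set"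
  assumes \<beta>: "\<beta> > 1" and region: "\<And>b. b > 0 \<Longrightarrow> \<exists>a. \<forall>z\<in>\<Sigma>. Re z \<le> a - b * \<bar>Im z\<bar> powr (1 / \<beta>)"
    and "p > 0" "\<alpha> > 0"
  shows "\<exists>c>0. \<forall>n. \<forall>z\<in>\<Sigma>. \<forall>s\<in>{p..q}. cmod z ^ n * exp (s * Re z) \<le> c * \<alpha> ^ n * fact n powr \<beta>"
proof -
  \<comment> \<open>Half of \<open>\<alpha>\<close>, because separating \<open>Re z\<close> from \<open>Im z\<close> in \<open>cmod z ^ n\<close> costs \<open>2 ^ n\<close>.\<close>
  define b where "b = \<beta> / (p * (\<alpha> / 2) powr (1 / \<beta>))"
  have "b > 0" using assms by (simp add: b_def)
  then obtain a' where a': "\<forall>z\<in>\<Sigma>. Re z \<le> a' - b * \<bar>Im z\<bar> powr (1 / \<beta>)" using region by blast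
  define a where "a = max a' 0"
  have a: "a \<ge> 0" "\<And>z. z \<in> \<Sigma> \<Longrightarrow> Re z \<le> a - b * \<bar>Im z\<bar> powr (1 / \<beta>)"
    using a' by (force simp: a_def)+
  obtain c where c: "c > 0" "\<And>n x s. x \<le> a \<Longrightarrow> s \<in> {p..q} \<Longrightarrow>
      \<bar>x\<bar> ^ n * exp (s * x) \<le> c * (\<alpha> / 2) ^ n * fact n powr \<beta>"
    using gevrey_estimate_Re[OF \<beta> a(1) \<open>p > 0\<close>, of "\<alpha> / 2" q] \<open>\<alpha> > 0\<close> by auto
  show ?thesis
  proof (intro exI conjI allI ballI)
    show "c + exp (q * a) > 0" using c(1) by (simp add: add_pos_pos)
    fix n z s assume z: "z \<in> \<Sigma>" and s: "s \<in> {p..q}"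
    let ?x = "\<bar>Re z\<bar>" and ?y = "\<bar>Im z\<bar>" and ?e = "exp (s * Re z)"
    have "cmod z \<le> ?x + ?y" by (rule cmod_le)
    also have "\<dots> \<le> 2 * max ?x ?y" by simp
    finally have "cmod z ^ n \<le> (2 * max ?x ?y) ^ n" by (intro power_mono) auto
    also have "\<dots> = 2 ^ n * max ?x ?y ^ n" by (rule power_mult_distrib)
    also have "\<dots> \<le> 2 ^ n * (?x ^ n + ?y ^ n)"
      by (intro mult_left_mono) (auto simp: max_def)
    finally have "cmod z ^ n * ?e \<le> 2 ^ n * (?x ^ n + ?y ^ n) * ?e"
      by (intro mult_right_mono) auto
    also have "\<dots> = 2 ^ n * (?x ^ n * ?e + ?y ^ n * ?e)" by (simp add: algebra_simps)
    also have "\<dots> \<le> 2 ^ n * (c * (\<alpha> / 2) ^ n * fact n powr \<beta> + exp (q * a) * (\<alpha> / 2) ^ n * fact n powr \<beta>)"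
    proof (intro mult_left_mono add_mono)
      have "0 \<le> b * ?y powr (1 / \<beta>)" using \<open>b > 0\<close> by simp
      then have "Re z \<le> a" using a(2)[OF z] by linarith
      then show "?x ^ n * ?e \<le> c * (\<alpha> / 2) ^ n * fact n powr \<beta>" using c(2) s by blast
      show "?y ^ n * ?e \<le> exp (q * a) * (\<alpha> / 2) ^ n * fact n powr \<beta>"
        using assms a z s by (intro gevrey_estimate_Im[OF _ _ _ b_def]) auto
    qed simp
    also have "\<dots> = (c + exp (q * a)) * \<alpha> ^ n * fact n powr \<beta>"
      by (simp add: power_divide algebra_simps)
    finally show "cmod z ^ n * ?e \<le> (c + exp (q * a)) * \<alpha> ^ n * fact n powr \<beta>" .
  qed
qed

text \<open>Take \<open>\<beta>\<close>-th roots, so that the bounds read \<open>y ^ n / fact n \<le> Q\<close> with \<open>y = (cmod w / \<alpha>) powr (1 / \<beta>)\<close>. Weighting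
  them by \<open>1 / 2 ^ n\<close> and summing gives \<open>exp (y / 2) \<le> 2 * Q\<close>, whose logarithm is the claim; the choice of \<open>\<alpha>\<close>
  turns \<open>\<beta> / 2 * y\<close> into \<open>b * cmod w powr (1 / \<beta>)\<close>.\<close>

lemma region_of_gevrey_bound:
  fixes \<beta> :: real
  assumes "\<beta> > 0" "b > 0" "K > 0" and \<alpha>: "\<alpha> = (\<beta> / (2 * b)) powr \<beta>"
    and le: "\<And>n. cmod w ^ n * exp (Re w) \<le> K * \<alpha> ^ n * fact n powr \<beta>"
  shows "Re w \<le> \<beta> * ln 2 + ln K - b * \<bar>Im w\<bar> powr (1 / \<beta>)"
proof -
  define y where "y = (cmod w / \<alpha>) powr (1 / \<beta>)"
  define Q where "Q = (K / exp (Re w)) powr (1 / \<beta>)"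
  have "\<alpha> > 0" using assms by simp
  have Q: "Q > 0" using assms by (simp add: Q_def)
  have y: "y ^ n \<le> fact n * Q" for n
  proof -
    have "(cmod w / \<alpha>) ^ n \<le> fact n powr \<beta> * (K / exp (Re w))"
      using le[of n] \<open>\<alpha> > 0\<close> by (simp add: power_divide field_simps)
    then have "((cmod w / \<alpha>) ^ n) powr (1 / \<beta>) \<le> (fact n powr \<beta> * (K / exp (Re w))) powr (1 / \<beta>)"
      using \<open>\<beta> > 0\<close> \<open>\<alpha> > 0\<close> by (intro powr_mono2) auto
    also have "\<dots> = fact n * Q"
      using \<open>\<beta> > 0\<close> by (subst powr_mult) (simp add: powr_powr Q_def)
    finally show ?thesis
      using \<open>\<alpha> > 0\<close> by (simp add: y_def power_powr_commute)
  qed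
  have "exp (y / 2) \<le> Q * 2"
  proof (rule sums_le)
    show "(y / 2) ^ n /\<^sub>R fact n \<le> Q * (1 / 2) ^ n" for n
      using y[of n] by (simp add: power_divide field_simps)
    show "(\<lambda>n. (y / 2) ^ n /\<^sub>R fact n) sums exp (y / 2)" by (rule exp_converges)
    show "(\<lambda>n. Q * (1 / 2) ^ n) sums (Q * 2)"
      using sums_mult[OF geometric_sums[of "1 / 2 :: real"], of Q] by simp
  qed
  then have "y / 2 \<le> ln (Q * 2)" using Q by (subst ln_ge_iff) auto
  also have "\<dots> = (ln K - Re w) / \<beta> + ln 2"
    using Q \<open>K > 0\<close> by (simp add: ln_mult Q_def ln_powr ln_div)
  finally have "\<beta> / 2 * y \<le> ln K - Re w + \<beta> * ln 2"
    using \<open>\<beta> > 0\<close> by (simp add: field_simps)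
  moreover have "\<beta> / 2 * y = b * cmod w powr (1 / \<beta>)"
  proof -
    have "\<alpha> powr (1 / \<beta>) = \<beta> / (2 * b)"
      using \<open>\<beta> > 0\<close> \<open>b > 0\<close> unfolding \<alpha> powr_powr by simp
    then show ?thesis
      using \<open>\<beta> > 0\<close> \<open>b > 0\<close> by (simp add: y_def powr_divide)
  qed
  moreover have "b * \<bar>Im w\<bar> powr (1 / \<beta>) \<le> b * cmod w powr (1 / \<beta>)"
    using assms by (intro mult_left_mono powr_mono2 abs_Im_le_cmod) auto
  ultimately show ?thesis by linarith
qed


section \<open>The spectrum of the generator of a Gevrey semigroup\<close>

lemma right_quotient_tendsto:
  fixes g :: "real \<Rightarrow> 'b::real_normed_vector"
  assumes "(g has_vector_derivative g') (at t)"
  shows "((\<lambda>h. (1 / h) *\<^sub>R (g (t + h) - g t)) \<longlongrightarrow> g') (at_right 0)"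
proof -
  have "(\<lambda>h. norm (g (t + h) - g t - h *\<^sub>R g') / norm h) \<midarrow>0\<rightarrow> 0"
    using assms by (simp add: has_vector_derivative_def has_derivative_at)
  then have "((\<lambda>h. norm (g (t + h) - g t - h *\<^sub>R g') / norm h) \<longlongrightarrow> 0) (at_right 0)"
    by (rule tendsto_mono[rotated]) (simp add: at_within_le_at)
  moreover have "\<forall>\<^sub>F h in at_right 0. norm (g (t + h) - g t - h *\<^sub>R g') / norm h =
      norm ((1 / h) *\<^sub>R (g (t + h) - g t) - g')"
    using eventually_at_right_less[of "0::real"]
  proof (rule eventually_mono)
    fix h :: real assume "0 < h"
    then have "(1 / h) *\<^sub>R (g (t + h) - g t) - g' = (1 / h) *\<^sub>R (g (t + h) - g t - h *\<^sub>R g')"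
      by (simp add: scaleR_diff_right)
    then show "norm (g (t + h) - g t - h *\<^sub>R g') / norm h = norm ((1 / h) *\<^sub>R (g (t + h) - g t) - g')"
      using \<open>0 < h\<close> by simp
  qed
  ultimately have "((\<lambda>h. norm ((1 / h) *\<^sub>R (g (t + h) - g t) - g')) \<longlongrightarrow> 0) (at_right 0)"
    by (rule Lim_transform_eventually)
  then show ?thesis
    by (simp add: tendsto_norm_zero_iff LIM_zero_iff)
qed

context scalar_type_operator
begin

text \<open>A differentiable orbit runs in the domain of the generator, since its right derivative at \<open>t\<close> is
  the limit that defines the generator at \<open>S t x\<close>. The derivative exists by assumption, so \<open>x\<close> may
  lie outside the domain.\<close>

lemma generator_orbit_derivative:
  assumes S: "C0_semigroup S" "is_generator S D A"
    and g': "((\<lambda>t. S t x) has_vector_derivative g') (at t)" and "t > 0"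
  shows "S t x \<in> D" "A (S t x) = g'"
proof -
  interpret C0_semigroup S by (rule S)
  have lim: "((\<lambda>h. (1 / h) *\<^sub>R (S h (S t x) - S t x)) \<longlongrightarrow> g') (at_right 0)"
  proof (rule Lim_transform_eventually[OF right_quotient_tendsto[OF g']])
    show "\<forall>\<^sub>F h in at_right 0. (1 / h) *\<^sub>R (S (t + h) x - S t x) = (1 / h) *\<^sub>R (S h (S t x) - S t x)"
      using eventually_at_right_less[of "0::real"]
    proof (rule eventually_mono)
      fix h :: real assume "0 < h"
      then have "S (t + h) x = S h (S t x)"
        using add[of h t] \<open>t > 0\<close> by (simp add: add.commute)
      then show "(1 / h) *\<^sub>R (S (t + h) x - S t x) = (1 / h) *\<^sub>R (S h (S t x) - S t x)" by simp
    qed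
  qed
  then show "S t x \<in> D" using S(2) unfolding is_generator_def by blast
  then have "((\<lambda>h. (1 / h) *\<^sub>R (S h (S t x) - S t x)) \<longlongrightarrow> A (S t x)) (at_right 0)"
    using S(2) unfolding is_generator_def by blast
  then show "A (S t x) = g'"
    using lim by (rule tendsto_unique[OF trivial_limit_at_right_real])
qed

text \<open>The semigroup is not assumed to commute with \<open>E\<close>. But \<open>\<Phi> (exp (- s z) * indicator \<delta>) (S s x)\<close> is constant in
  \<open>s\<close>: its derivative consists of two terms that cancel by \<open>\<Phi>_A\<close>. Comparing \<open>s = t\<close> with the limit
  at \<open>s = 0\<close> and applying \<open>\<Phi> (exp (t z) * indicator \<delta>)\<close> gives the formula.\<close>

lemma E_semigroup:
  assumes S: "C0_semigroup S" "is_generator S D A"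
    and diff: "\<And>t. t > 0 \<Longrightarrow> (\<lambda>t. S t x) differentiable (at t)"
    and \<delta>: "\<delta> \<in> sets borel" "bounded \<delta>" and "t > 0"
  shows "E \<delta> (S t x) = \<Phi> (exp_monomial \<delta> 0 t) x"
proof -
  interpret C0_semigroup S by (rule S)
  have b: "bounded_borel (exp_monomial \<delta> n s)" for n s
    by (rule bounded_borel_exp_monomial[OF \<delta>(1) exp_dominated_bounded[OF \<delta>(2), of s 1]]) simp
  let ?w = "\<lambda>s. \<Phi> (exp_monomial \<delta> 0 (- s)) (S s x)"
  have "(?w has_derivative (\<lambda>h. 0)) (at s)" if "s > 0" for s
  proof -
    let ?g' = "vector_derivative (\<lambda>t. S t x) (at s)"
    have g': "((\<lambda>t. S t x) has_vector_derivative ?g') (at s)"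
      using diff[OF that] by (simp add: vector_derivative_works)
    note orbit = generator_orbit_derivative[OF S g' that]
    have "\<Phi> (exp_monomial \<delta> 0 (- s)) (A (S s x)) = \<Phi> (exp_monomial \<delta> 1 (- s)) (S s x)"
      by (rule \<Phi>_A[OF b b _ orbit(1)]) (simp add: exp_monomial_def)
    then show ?thesis
      using \<Phi>_exp_product_rule[OF \<delta> g'] orbit(2) by (simp add: has_vector_derivative_def)
  qed
  then have const: "?w s = ?w t" if "s > 0" for s
    using has_derivative_zero_unique_connected[of "{0<..}" ?w s t] that \<open>t > 0\<close> by auto
  have "(?w \<longlongrightarrow> ?w 0) (at_right 0)"
  proof -
    have "continuous_on {0..} ?w" by (rule \<Phi>_exp_continuous[OF \<delta> strongly_continuous])
    then have "(?w \<longlongrightarrow> ?w 0) (at 0 within {0..})"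
      unfolding continuous_on_def by (rule bspec) simp
    then show ?thesis by (rule tendsto_within_subset) auto
  qed
  moreover have "(?w \<longlongrightarrow> ?w t) (at_right 0)"
    by (rule tendsto_eventually, rule eventually_mono[OF eventually_at_right_less[of "0::real"]]) (rule const)
  ultimately have "?w t = ?w 0"
    using tendsto_unique trivial_limit_at_right_real by blast
  have inverse: "\<Phi> (exp_monomial \<delta> 0 t) (\<Phi> (exp_monomial \<delta> 0 (- t)) y) = E \<delta> y" for y
  proof -
    have "(\<lambda>z. exp_monomial \<delta> 0 t z * exp_monomial \<delta> 0 (- t) z) = indicator \<delta>"
      by (auto simp: exp_monomial_def indicator_def simp flip: exp_add)
    then show ?thesis
      using \<Phi>_mult[OF b[of 0 t] b[of 0 "- t"], of y] \<delta>(1) by (simp add: \<Phi>_indicator)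
  qed
  have "E \<delta> (S t x) = \<Phi> (exp_monomial \<delta> 0 t) (?w 0)"
    using inverse[of "S t x"] \<open>?w t = ?w 0\<close> by simp
  also have "?w 0 = E \<delta> x"
  proof -
    have "exp_monomial \<delta> 0 0 = indicator \<delta>" by (auto simp: exp_monomial_def)
    then show ?thesis using \<delta>(1) by (simp add: zero \<Phi>_indicator)
  qed
  also have "\<Phi> (exp_monomial \<delta> 0 t) (E \<delta> x) = \<Phi> (\<lambda>z. exp_monomial \<delta> 0 t z * indicator \<delta> z) x"
    by (rule \<Phi>_mult_indicator(1)[OF b \<delta>(1), symmetric])
  also have "(\<lambda>z. exp_monomial \<delta> 0 t z * indicator \<delta> z) = exp_monomial \<delta> 0 t"
    by (auto simp: exp_monomial_def indicator_def)
  finally show ?thesis .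
qed

lemma E_higher_derivative_semigroup:
  assumes S: "C0_semigroup S" "is_generator S D A"
    and diff: "infinitely_differentiable_on (\<lambda>t. S t x) {0<..}"
    and \<delta>: "\<delta> \<in> sets borel" "bounded \<delta>" and "t > 0"
  shows "E \<delta> (higher_vector_derivative n (\<lambda>t. S t x) t) = \<Phi> (exp_monomial \<delta> n t) x"
proof -
  let ?g = "\<lambda>n. higher_vector_derivative n (\<lambda>t. S t x)"
  have g: "?g n differentiable (at t)" if "t > 0" for n t
    using diff that by (simp add: infinitely_differentiable_on_def)
  have g': "(?g n has_vector_derivative ?g (Suc n) t) (at t)" if "t > 0" for n t
    using g[OF that] by (simp add: vector_derivative_works higher_vector_derivative_def)
  have "\<forall>t>0. E \<delta> (?g n t) = \<Phi> (exp_monomial \<delta> n t) x"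
  proof (induction n)
    case 0
    have "?g 0 = (\<lambda>t. S t x)" by (simp add: higher_vector_derivative_def)
    then show ?case using E_semigroup[OF S _ \<delta>] g[of _ 0] by simp
  next
    case (Suc n)
    show ?case
    proof (intro allI impI)
      fix t :: real assume t: "t > 0"
      have "((\<lambda>t. E \<delta> (?g n t)) has_vector_derivative E \<delta> (?g (Suc n) t)) (at t)"
        by (rule bounded_linear.has_vector_derivative[OF bounded_linear_E[OF \<delta>(1)] g'[OF t]])
      moreover have "((\<lambda>t. E \<delta> (?g n t)) has_vector_derivative \<Phi> (exp_monomial \<delta> (Suc n) t) x) (at t)"
        by (rule has_vector_derivative_transform_within_open[OF
              \<Phi>_exp_monomial_has_derivative[OF \<delta>(1) exp_dominated_bounded[OF \<delta>(2), of t 1]], of "{0<..}"])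
          (use t Suc in auto)
      ultimately show "E \<delta> (?g (Suc n) t) = \<Phi> (exp_monomial \<delta> (Suc n) t) x"
        by (rule vector_derivative_unique_at)
    qed
  qed
  with \<open>t > 0\<close> show ?thesis by blast
qed

text \<open>Dividing \<open>\<Phi> (z ^ n * exp z * indicator \<delta>)\<close> by \<open>\<alpha> ^ n * fact n powr \<beta>\<close>, for all \<open>n\<close> and all bounded \<open>\<delta>\<close>, gives
  a family that is bounded at each vector, by the Gevrey estimate of its orbit at time \<open>1\<close>. The
  uniform bound of the family is the constant \<open>K\<close>.\<close>

lemma gevrey_semigroup_spectrum_bound:
  assumes S: "gevrey_beurling_semigroup \<beta> S" "is_generator S D A" and "\<alpha> > 0"
  shows "\<exists>K>0. \<forall>w\<in>\<sigma>. \<forall>n. cmod w ^ n * exp (Re w) \<le> K * \<alpha> ^ n * fact n powr \<beta>"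
proof -
  have C0: "C0_semigroup S" and gevrey: "\<And>x. gevrey_beurling \<beta> (\<lambda>t. S t x)"
    using S(1) by (auto simp: gevrey_beurling_semigroup_def)
  let ?m = "\<lambda>n. \<alpha> ^ n * fact n powr \<beta>"
  have m: "?m n > 0" for n using \<open>\<alpha> > 0\<close> by simp
  let ?I = "{(n :: nat, \<delta> :: complex set). \<delta> \<in> sets borel \<and> bounded \<delta>}"
  let ?T = "\<lambda>(n, \<delta>) x. (1 / ?m n) *\<^sub>R \<Phi> (exp_monomial \<delta> n 1) x"
  have "\<exists>K>0. \<forall>i\<in>?I. \<forall>x. norm (?T i x) \<le> K * norm x"
  proof (rule uniform_boundedness)
    fix i assume i: "i \<in> ?I"
    obtain n \<delta> where i': "i = (n, \<delta>)" by fastforce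
    then have "bounded_borel (exp_monomial \<delta> n 1)"
      using i by (intro bounded_borel_exp_monomial[where t = 1 and r = 1] exp_dominated_bounded) auto
    then show "bounded_linear (?T i)"
      unfolding i' by (simp add: bounded_linear_const_scaleR bounded_linear_\<Phi>)
  next
    fix x
    have inf: "infinitely_differentiable_on (\<lambda>t. S t x) {0<..}"
      using gevrey by (simp add: gevrey_beurling_def)
    obtain c where c: "\<And>n. norm (higher_vector_derivative n (\<lambda>t. S t x) 1) \<le> c * \<alpha> ^ n * fact n powr \<beta>"
      using gevrey[of x] \<open>\<alpha> > 0\<close> unfolding gevrey_beurling_def
      by (metis atLeastAtMost_iff order_refl zero_less_one)
    have "norm (?T i x) \<le> projection_bound * c" if i: "i \<in> ?I" for i
    proof -
      obtain n \<delta> where i': "i = (n, \<delta>)" by fastforce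
      with i have \<delta>: "\<delta> \<in> sets borel" "bounded \<delta>" by auto
      have "norm (\<Phi> (exp_monomial \<delta> n 1) x) = norm (E \<delta> (higher_vector_derivative n (\<lambda>t. S t x) 1))"
        by (simp add: E_higher_derivative_semigroup[OF C0 S(2) inf \<delta>])
      also have "\<dots> \<le> projection_bound * norm (higher_vector_derivative n (\<lambda>t. S t x) 1)"
        by (rule norm_E_le[OF \<delta>(1)])
      also have "\<dots> \<le> projection_bound * (c * \<alpha> ^ n * fact n powr \<beta>)"
        using c projection_bound_pos by (intro mult_left_mono) auto
      finally have "norm (\<Phi> (exp_monomial \<delta> n 1) x) \<le> projection_bound * c * ?m n"
        by (simp add: mult.assoc)
      then show ?thesis using m[of n] by (simp add: i' divide_le_eq)
    qed
    then show "\<exists>B. \<forall>i\<in>?I. norm (?T i x) \<le> B" by blast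
  qed
  then obtain K where K: "K > 0" "\<And>i x. i \<in> ?I \<Longrightarrow> norm (?T i x) \<le> K * norm x" by blast
  show ?thesis
  proof (intro exI conjI ballI allI)
    show "K > 0" by (rule K)
    fix w n assume w: "w \<in> \<sigma>"
    have "cmod (w ^ n * exp (of_real 1 * w)) \<le> K * ?m n"
    proof (rule cmod_le_of_norm_\<Phi>_le[OF _ w])
      show "continuous_on UNIV (\<lambda>z :: complex. z ^ n * exp (of_real 1 * z))"
        by (intro continuous_intros)
      fix \<delta> :: "complex set" and x assume \<delta>: "\<delta> \<in> sets borel" "bounded \<delta>"
      have "(1 / ?m n) * norm (\<Phi> (exp_monomial \<delta> n 1) x) \<le> K * norm x"
        using K(2)[of "(n, \<delta>)" x] \<delta> m[of n] by simp
      then have "norm (\<Phi> (exp_monomial \<delta> n 1) x) \<le> K * ?m n * norm x"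
        using m[of n] by (simp add: divide_le_eq mult_ac)
      then show "norm (\<Phi> (\<lambda>z. z ^ n * exp (of_real 1 * z) * indicator \<delta> z) x) \<le> K * ?m n * norm x"
        by (simp add: exp_monomial_def[abs_def])
    qed
    then show "cmod w ^ n * exp (Re w) \<le> K * \<alpha> ^ n * fact n powr \<beta>"
      by (simp add: norm_mult norm_power mult.assoc)
  qed
qed

end


theorem corollary4p1:
  fixes A :: "'a::complex_banach \<Rightarrow> 'a" and D :: "'a set" and \<beta> :: real
  assumes "\<beta> > 1"
    and "scalar_type_spectral D A"
  shows "(\<exists>S. gevrey_beurling_semigroup \<beta> S \<and> is_generator S D A) \<longleftrightarrow>
    (\<forall>b>0. \<exists>a. \<forall>z\<in>spectrum D A. Re z \<le> a - b * \<bar>Im z\<bar> powr (1 / \<beta>))"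
proof -
  obtain E where closed: "densely_defined_closed_operator D A" and E: "spectral_measure E"
    "E (spectrum D A) = id" "D = spectral_integral_domain E (spectrum D A) (\<lambda>z. z)"
    "\<forall>x\<in>D. A x = spectral_integral E (spectrum D A) (\<lambda>z. z) x"
    using assms(2) unfolding scalar_type_spectral_def by blast
  have "scalar_type_operator D A E"
    by (intro scalar_type_operator.intro closed E(1) scalar_type_operator_axioms.intro)
      (use E in auto)
  then interpret scalar_type_operator D A E .
  show ?thesis
  proof
    assume "\<exists>S. gevrey_beurling_semigroup \<beta> S \<and> is_generator S D A"
    then obtain S where S: "gevrey_beurling_semigroup \<beta> S" "is_generator S D A" by blast
    show "\<forall>b>0. \<exists>a. \<forall>z\<in>\<sigma>. Re z \<le> a - b * \<bar>Im z\<bar> powr (1 / \<beta>)"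
    proof (intro allI impI)
      fix b :: real assume "b > 0"
      define \<alpha> where "\<alpha> = (\<beta> / (2 * b)) powr \<beta>"
      have "\<alpha> > 0" using assms(1) \<open>b > 0\<close> by (simp add: \<alpha>_def)
      then obtain K where "K > 0"
        "\<forall>w\<in>\<sigma>. \<forall>n. cmod w ^ n * exp (Re w) \<le> K * \<alpha> ^ n * fact n powr \<beta>"
        using gevrey_semigroup_spectrum_bound[OF S] by blast
      then have "\<forall>z\<in>\<sigma>. Re z \<le> (\<beta> * ln 2 + ln K) - b * \<bar>Im z\<bar> powr (1 / \<beta>)"
        using assms(1) \<open>b > 0\<close> by (intro ballI region_of_gevrey_bound[OF _ _ _ \<alpha>_def]) auto
      then show "\<exists>a. \<forall>z\<in>\<sigma>. Re z \<le> a - b * \<bar>Im z\<bar> powr (1 / \<beta>)" ..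
    qed
  next
    assume region: "\<forall>b>0. \<exists>a. \<forall>z\<in>\<sigma>. Re z \<le> a - b * \<bar>Im z\<bar> powr (1 / \<beta>)"
    then obtain \<omega> where a: "\<forall>z\<in>\<sigma>. Re z \<le> \<omega> - 1 * \<bar>Im z\<bar> powr (1 / \<beta>)"
      using zero_less_one by blast
    then have \<omega>: "Re z \<le> \<omega>" if "z \<in> \<sigma>" for z
      using bspec[OF a that] powr_ge_zero[of "\<bar>Im z\<bar>" "1 / \<beta>"] by linarith
    have "gevrey_beurling \<beta> (\<lambda>t. \<Phi> (exp_monomial \<sigma> 0 t) x)" for x
      using region by (intro gevrey_beurling_exp gevrey_estimate[OF assms(1)]) auto
    then have "gevrey_beurling_semigroup \<beta> (\<lambda>t. \<Phi> (exp_monomial \<sigma> 0 t))"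
      using semigroup_exp[OF \<omega>] by (simp add: gevrey_beurling_semigroup_def)
    then show "\<exists>S. gevrey_beurling_semigroup \<beta> S \<and> is_generator S D A"
      using generator_exp[OF \<omega>] by blast
  qed
qed

end
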